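(* Suppose $\Omega_1\subset\mathbb{R}^{d_1}$ and $\Omega_2\subset\mathbb{R}^{d_2}$, $d_1,d_2\geq 1$, are two bounded open sets which are Dirichlet regular, such that $\Omega_1$ is connected. Suppose also that $U:C_0(\Omega_1)\to C_0(\Omega_2)$ is an invertible disjointness-preserving operator which intertwines the Dirichlet Laplacians on $C_0(\Omega_1)$ and $C_0(\Omega_2)$. Then $d_1=d_2=:d$ and there exist an isometry $\tau:\mathbb{R}^d\to\mathbb{R}^d$ with $\tau(\Omega_2)=\Omega_1$ and a constant $c\in\mathbb{C}\setminus\{0\}$ such that $$Uf=c\,f\circ\tau\qquad\text{for all } f\in C_0(\Omega_1).$$
   Context: Functions are complex-valued and open sets are non-empty. For an open set $\Omega\subset\mathbb{R}^d$, $C_0(\Omega)$ is the closure of $C_c^\infty(\Omega)$ with respect to the supremum norm, equipped with this norm. The Dirichlet Laplacian on $C_0(\Omega)$ is given by $D(\Delta^D_{C_0(\Omega)})=\{u\in C_0(\Omega):\Delta u\in C_0(\Omega)\}$, $\Delta^D_{C_0(\Omega)}u=\Delta u$, with $\Delta u$ in the sense of distributions. A bounded open set $\Omega$ is Dirichlet regular if for each $g\in C(\partial\Omega)$ there exists $u\in C^2(\Omega)\cap C(\overline\Omega)$ with $\Delta u=0$ in $\Omega$ and $u|_{\partial\Omega}=g$. An operator $U:X_1\to X_2$ between Banach spaces intertwines linear operators $A_1:D(A_1)\subset X_1\to X_1$ and $A_2:D(A_2)\subset X_2\to X_2$ if $x\in D(A_1)$ implies $Ux\in D(A_2)$ and $A_2Ux=UA_1x$.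 A bounded linear operator $U:C_0(\Omega_1)\to C_0(\Omega_2)$ is disjointness-preserving if $f\cdot g=0$ implies $(Uf)\cdot(Ug)=0$ for all $f,g\in C_0(\Omega_1)$; invertible means bijective (hence with bounded inverse). *)

theory Defs
  imports "HOL-Analysis.Analysis"
begin

text \<open>
  Here \<open>\<real>\<^sup>d\<close> is an arbitrary \<open>'a::euclidean_space\<close> with \<open>d = DIM('a)\<close>, which is always
  at least 1; coordinates are taken with respect to \<open>Basis\<close>.
\<close>

definition partial :: "'a::euclidean_space \<Rightarrow> ('a \<Rightarrow> complex) \<Rightarrow> 'a \<Rightarrow> complex" where
  "partial i f x = frechet_derivative f (at x) i"

definition laplacian :: "('a::euclidean_space \<Rightarrow> complex) \<Rightarrow> 'a \<Rightarrow> complex" where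
  "laplacian f x = (\<Sum>i\<in>Basis. partial i (partial i f) x)"

text \<open>\<open>C\<^sup>k\<close> on an open set \<open>S\<close>.\<close>

primrec Ck_on :: "nat \<Rightarrow> 'a::euclidean_space set \<Rightarrow> ('a \<Rightarrow> complex) \<Rightarrow> bool" where
  "Ck_on 0 S f \<longleftrightarrow> continuous_on S f"
| "Ck_on (Suc k) S f \<longleftrightarrow>
     (\<forall>x\<in>S. f differentiable (at x)) \<and> (\<forall>i\<in>Basis. Ck_on k S (partial i f))"

text \<open>Elements of \<open>C\<^sub>c\<^sup>\<infinity>(\<Omega>)\<close> and \<open>C\<^sub>0(\<Omega>)\<close> are extended by zero to the whole space.\<close>

definition test_functions :: "'a::euclidean_space set \<Rightarrow> ('a \<Rightarrow> complex) set" where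
  "test_functions \<Omega> =
     {\<phi>. (\<forall>k. Ck_on k UNIV \<phi>) \<and> compact (closure {x. \<phi> x \<noteq> 0}) \<and> closure {x. \<phi> x \<noteq> 0} \<subseteq> \<Omega>}"

text \<open>
  The closure is taken in the type of bounded continuous functions, whose norm is the
  supremum norm.
\<close>

definition C0 :: "'a::euclidean_space set \<Rightarrow> ('a \<Rightarrow>\<^sub>C complex) set" where
  "C0 \<Omega> = closure {u. apply_bcontfun u \<in> test_functions \<Omega>}"

text \<open>\<open>\<Delta>u = w\<close> in the sense of distributions on \<open>\<Omega>\<close>.\<close>

definition distr_laplacian ::
    "'a::euclidean_space set \<Rightarrow> ('a \<Rightarrow> complex) \<Rightarrow> ('a \<Rightarrow> complex) \<Rightarrow> bool" where
  "distr_laplacian \<Omega> u w \<longleftrightarrow>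
     (\<forall>\<phi>\<in>test_functions \<Omega>.
        (LINT x:\<Omega>|lborel. u x * laplacian \<phi> x) = (LINT x:\<Omega>|lborel. w x * \<phi> x))"

definition dom_dirichlet_laplacian :: "'a::euclidean_space set \<Rightarrow> ('a \<Rightarrow>\<^sub>C complex) set" where
  "dom_dirichlet_laplacian \<Omega> = {u \<in> C0 \<Omega>. \<exists>w\<in>C0 \<Omega>. distr_laplacian \<Omega> u w}"

text \<open>
  The function described is unique for bounded open \<open>\<Omega>\<close>, see
  \<open>dirichlet_laplacian_eqI\<close> below.
\<close>

definition dirichlet_laplacian ::
    "'a::euclidean_space set \<Rightarrow> ('a \<Rightarrow>\<^sub>C complex) \<Rightarrow> ('a \<Rightarrow>\<^sub>C complex)" where
  "dirichlet_laplacian \<Omega> u = (THE w. w \<in> C0 \<Omega> \<and> distr_laplacian \<Omega> u w)"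

definition dirichlet_regular :: "'a::euclidean_space set \<Rightarrow> bool" where
  "dirichlet_regular \<Omega> \<longleftrightarrow>
     (\<forall>g. continuous_on (frontier \<Omega>) g \<longrightarrow>
        (\<exists>u. Ck_on 2 \<Omega> u \<and> continuous_on (closure \<Omega>) u \<and>
             (\<forall>x\<in>\<Omega>. laplacian u x = 0) \<and> (\<forall>x\<in>frontier \<Omega>. u x = g x)))"

text \<open>
  The library provides only the real vector space structure on \<open>'a \<Rightarrow>\<^sub>C complex\<close>, so
  multiplication by complex scalars is defined here.
\<close>

definition cscale ::
    "complex \<Rightarrow> ('a::topological_space \<Rightarrow>\<^sub>C complex) \<Rightarrow> ('a \<Rightarrow>\<^sub>C complex)" where
  "cscale a f = Bcontfun (\<lambda>x. a * f x)"

lemma apply_cscale [simp]: "cscale a f x = a * f x"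
proof -
  have "(\<lambda>x. a * f x) \<in> bcontfun"
    by (rule bcontfun_normI[where b = "norm a * norm f"])
       (auto simp: norm_mult intro!: continuous_intros mult_left_mono norm_bounded)
  then show ?thesis by (simp add: cscale_def Bcontfun_inverse)
qed

definition bounded_operator ::
    "'a::euclidean_space set \<Rightarrow> 'b::euclidean_space set \<Rightarrow>
     (('a \<Rightarrow>\<^sub>C complex) \<Rightarrow> ('b \<Rightarrow>\<^sub>C complex)) \<Rightarrow> bool" where
  "bounded_operator \<Omega>1 \<Omega>2 U \<longleftrightarrow>
     (\<forall>f\<in>C0 \<Omega>1. U f \<in> C0 \<Omega>2) \<and>
     (\<forall>f\<in>C0 \<Omega>1. \<forall>g\<in>C0 \<Omega>1. U (f + g) = U f + U g) \<and>
     (\<forall>a. \<forall>f\<in>C0 \<Omega>1. U (cscale a f) = cscale a (U f)) \<and>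
     (\<exists>K. \<forall>f\<in>C0 \<Omega>1. norm (U f) \<le> K * norm f)"

definition disjointness_preserving ::
    "'a::euclidean_space set \<Rightarrow> 'b::euclidean_space set \<Rightarrow>
     (('a \<Rightarrow>\<^sub>C complex) \<Rightarrow> ('b \<Rightarrow>\<^sub>C complex)) \<Rightarrow> bool" where
  "disjointness_preserving \<Omega>1 \<Omega>2 U \<longleftrightarrow>
     (\<forall>f\<in>C0 \<Omega>1. \<forall>g\<in>C0 \<Omega>1.
        (\<forall>x\<in>\<Omega>1. apply_bcontfun f x * apply_bcontfun g x = 0) \<longrightarrow>
        (\<forall>y\<in>\<Omega>2. apply_bcontfun (U f) y * apply_bcontfun (U g) y = 0))"

definition intertwines ::
    "('x \<Rightarrow> 'y) \<Rightarrow> 'x set \<Rightarrow> ('x \<Rightarrow> 'x) \<Rightarrow> 'y set \<Rightarrow> ('y \<Rightarrow> 'y) \<Rightarrow> bool" where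
  "intertwines U D1 A1 D2 A2 \<longleftrightarrow> (\<forall>x\<in>D1. U x \<in> D2 \<and> A2 (U x) = U (A1 x))"


subsection \<open>Well-definedness of the Dirichlet Laplacian\<close>

lemma partial_diff:
  assumes "\<And>x. f differentiable (at x)" "\<And>x. g differentiable (at x)"
  shows "partial i (\<lambda>x. f x - g x) = (\<lambda>x. partial i f x - partial i g x)"
proof
  fix x
  have "((\<lambda>x. f x - g x) has_derivative
         (\<lambda>h. frechet_derivative f (at x) h - frechet_derivative g (at x) h)) (at x)"
    using assms by (intro has_derivative_diff) (auto simp: frechet_derivative_works[symmetric])
  then show "partial i (\<lambda>x. f x - g x) x = partial i f x - partial i g x"
    unfolding partial_def by (metis frechet_derivative_at)
qed

lemma partial_cnj:
  assumes "\<And>x. f differentiable (at x)"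
  shows "partial i (\<lambda>x. cnj (f x)) = (\<lambda>x. cnj (partial i f x))"
proof
  fix x
  have "((\<lambda>x. cnj (f x)) has_derivative (\<lambda>h. cnj (frechet_derivative f (at x) h))) (at x)"
    using assms by (intro has_derivative_cnj) (auto simp: frechet_derivative_works[symmetric])
  then show "partial i (\<lambda>x. cnj (f x)) x = cnj (partial i f x)"
    unfolding partial_def by (metis frechet_derivative_at)
qed

lemma Ck_diff: "Ck_on k UNIV f \<Longrightarrow> Ck_on k UNIV g \<Longrightarrow> Ck_on k UNIV (\<lambda>x. f x - g x)"
proof (induction k arbitrary: f g)
  case (Suc k)
  then show ?case by (simp add: partial_diff)
qed (auto intro: continuous_on_diff)

lemma Ck_cnj: "Ck_on k UNIV f \<Longrightarrow> Ck_on k UNIV (\<lambda>x. cnj (f x))"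
proof (induction k arbitrary: f)
  case (Suc k)
  moreover have "(\<lambda>x. cnj (f x)) differentiable (at x)" for x
  proof -
    obtain D where "(f has_derivative D) (at x)"
      using Suc.prems by (auto simp: differentiable_def)
    then show ?thesis unfolding differentiable_def by (intro exI) (rule has_derivative_cnj)
  qed
  ultimately show ?case by (simp add: partial_cnj)
qed (auto intro: continuous_on_cnj)

lemma test_functions_cnj_diff:
  assumes "f \<in> test_functions \<Omega>" "g \<in> test_functions \<Omega>"
  shows "(\<lambda>x. cnj (f x - g x)) \<in> test_functions \<Omega>"
proof -
  let ?F = "closure {x. f x \<noteq> 0}" and ?G = "closure {x. g x \<noteq> 0}"
  let ?H = "closure {x. cnj (f x - g x) \<noteq> 0}"
  have "?H \<subseteq> closure ({x. f x \<noteq> 0} \<union> {x. g x \<noteq> 0})" by (rule closure_mono) auto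
  then have sub: "?H \<subseteq> ?F \<union> ?G" by (simp only: closure_Un)
  have "compact (?F \<union> ?G)"
    using assms by (auto simp: test_functions_def intro: compact_Un)
  then have "compact ?H"
    using sub compact_Int_closed[of "?F \<union> ?G" ?H] by (simp add: inf.absorb2)
  moreover have "?H \<subseteq> \<Omega>"
    using sub assms by (auto simp: test_functions_def)
  moreover have "Ck_on k UNIV (\<lambda>x. cnj (f x - g x))" for k
    using assms by (intro Ck_cnj Ck_diff) (auto simp: test_functions_def)
  ultimately show ?thesis by (simp add: test_functions_def)
qed

lemma C0_approx:
  assumes "u \<in> C0 \<Omega>" "e > 0"
  obtains v where "apply_bcontfun v \<in> test_functions \<Omega>" "\<And>x. norm (u x - v x) < e"
proof -
  obtain v where v: "apply_bcontfun v \<in> test_functions \<Omega>" "dist v u < e"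
    using assms unfolding C0_def closure_approachable by auto
  have "norm (u x - v x) < e" for x
    using dist_fun_lt_imp_dist_val_lt[OF v(2)] by (simp add: dist_norm norm_minus_commute)
  then show ?thesis using v(1) that by blast
qed

lemma C0_zero:
  assumes "u \<in> C0 \<Omega>" "x \<notin> \<Omega>"
  shows "apply_bcontfun u x = 0"
proof (rule ccontr)
  assume "u x \<noteq> 0"
  then obtain v where v: "apply_bcontfun v \<in> test_functions \<Omega>" "norm (u x - v x) < norm (u x)"
    using C0_approx[OF assms(1), of "norm (u x)"] by (metis zero_less_norm_iff)
  then have "v x \<noteq> 0" by auto
  then have "x \<in> closure {x. v x \<noteq> 0}" by (intro subsetD[OF closure_subset]) simp
  then show False using v(1) assms(2) by (auto simp: test_functions_def)
qed

lemma set_integrable_bounded_continuous: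
  fixes f :: "'a::euclidean_space \<Rightarrow> complex"
  assumes "open \<Omega>" "bounded \<Omega>" "continuous_on UNIV f" "\<And>x. norm (f x) \<le> B"
  shows "set_integrable lborel \<Omega> f"
proof -
  have fin: "emeasure lborel \<Omega> < \<infinity>" using assms emeasure_bounded_finite by blast
  have [measurable]: "f \<in> borel_measurable borel" "\<Omega> \<in> sets borel"
    using assms by (auto intro: borel_measurable_continuous_onI)
  have "integrable lborel (\<lambda>x. indicator \<Omega> x *\<^sub>R B :: real)"
    using fin by (intro integrable_scaleR_left integrable_real_indicator) auto
  then show ?thesis unfolding set_integrable_def
  proof (rule Bochner_Integration.integrable_bound)
    show "AE x in lborel. norm (indicator \<Omega> x *\<^sub>R f x) \<le> norm (indicator \<Omega> x *\<^sub>R B)"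
      using assms(4) by (auto simp: indicator_def intro!: AE_I2 order_trans[OF _ abs_ge_self])
  qed auto
qed

lemma distr_laplacian_unique:
  fixes w1 w2 :: "'a::euclidean_space \<Rightarrow>\<^sub>C complex"
  assumes \<Omega>: "open \<Omega>" "bounded \<Omega>"
    and C0: "w1 \<in> C0 \<Omega>" "w2 \<in> C0 \<Omega>"
    and "distr_laplacian \<Omega> u w1" "distr_laplacian \<Omega> u w2"
  shows "w1 = w2"
proof -
  define w where "w = w1 - w2"
  define I where "I = (LINT x:\<Omega>|lborel. (norm (w x))\<^sup>2)"
  have bd: "norm (f x) \<le> norm f" for f :: "'a \<Rightarrow>\<^sub>C complex" and x by (rule norm_bounded)
  have int: "set_integrable lborel \<Omega> (\<lambda>x. f x * g x)"
    if "continuous_on UNIV f" "continuous_on UNIV g" "\<And>x. norm (f x) \<le> A" "\<And>x. norm (g x) \<le> B"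
    for f g :: "'a \<Rightarrow> complex" and A B
  proof (rule set_integrable_bounded_continuous[where B = "A * B"])
    show "norm (f x * g x) \<le> A * B" for x
      unfolding norm_mult
      by (rule mult_mono[OF that(3) that(4) order_trans[OF norm_ge_zero that(3)] norm_ge_zero])
  qed (use that \<Omega> in \<open>auto intro: continuous_intros\<close>)
  have fin: "emeasure lborel \<Omega> < \<infinity>" using \<Omega> emeasure_bounded_finite by blast
  have intsq: "set_integrable lborel \<Omega> (\<lambda>x. w x * cnj (w x))"
    by (rule int[where A = "norm w" and B = "norm w"]) (auto intro!: continuous_intros bd)
  have eqc: "(LINT x:\<Omega>|lborel. w x * cnj (w x)) = of_real I"
    unfolding I_def complex_norm_square[symmetric] set_lebesgue_integral_def
    by (simp flip: of_real_power integral_complex_of_real add: scaleR_conv_of_real)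
  have bound: "\<bar>I\<bar> \<le> e * (norm w * measure lborel \<Omega>)" if "e > 0" for e
  proof -
    have e2: "e/2 > 0" using that by simp
    obtain v1 where v1: "apply_bcontfun v1 \<in> test_functions \<Omega>" "\<And>x. norm (w1 x - v1 x) < e/2"
      using C0_approx[OF C0(1) e2] by blast
    obtain v2 where v2: "apply_bcontfun v2 \<in> test_functions \<Omega>" "\<And>x. norm (w2 x - v2 x) < e/2"
      using C0_approx[OF C0(2) e2] by blast
    define v where "v = v1 - v2"
    have test: "(\<lambda>x. cnj (v x)) \<in> test_functions \<Omega>"
      using test_functions_cnj_diff[OF v1(1) v2(1)] by (simp add: v_def)
    have near: "norm (w x - v x) \<le> e" for x
    proof -
      have "w x - v x = (w1 x - v1 x) - (w2 x - v2 x)" by (simp add: w_def v_def)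
      also have "norm \<dots> \<le> e/2 + e/2"
        using norm_triangle_ineq4[of "w1 x - v1 x" "w2 x - v2 x"] v1(2)[of x] v2(2)[of x]
        by linarith
      finally show ?thesis by simp
    qed
    have i: "set_integrable lborel \<Omega> (\<lambda>x. f x * cnj (v x))" for f :: "'a \<Rightarrow>\<^sub>C complex"
      by (rule int[where A = "norm f" and B = "norm v"]) (auto intro!: continuous_intros bd)
    have "(LINT x:\<Omega>|lborel. w x * cnj (v x)) =
          (LINT x:\<Omega>|lborel. w1 x * cnj (v x)) - (LINT x:\<Omega>|lborel. w2 x * cnj (v x))"
      by (subst set_integral_diff(2)[symmetric]) (auto intro: i simp: w_def left_diff_distrib)
    also have "\<dots> = 0"
      using assms(5,6) test by (auto simp: distr_laplacian_def)
    finally have z: "(LINT x:\<Omega>|lborel. w x * cnj (v x)) = 0" .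
    have id: "set_integrable lborel \<Omega> (\<lambda>x. w x * cnj (w x - v x))"
      by (rule int[where A = "norm w" and B = e])
         (auto intro!: continuous_intros bd near simp flip: complex_cnj_diff)
    have "complex_of_real I = (LINT x:\<Omega>|lborel. w x * cnj (w x - v x))"
      unfolding eqc[symmetric] using set_integral_diff(2)[OF intsq i[of w]] z
      by (simp add: right_diff_distrib)
    then have "\<bar>I\<bar> = norm (LINT x:\<Omega>|lborel. w x * cnj (w x - v x))"
      by (metis norm_of_real real_norm_def)
    also have "\<dots> \<le> (LINT x:\<Omega>|lborel. norm (w x * cnj (w x - v x)))"
      by (rule set_integral_norm_bound[OF id])
    also have "\<dots> \<le> (LINT x:\<Omega>|lborel. norm w * e)"
    proof (rule set_integral_mono)
      show "set_integrable lborel \<Omega> (\<lambda>x. norm w * e)"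
        unfolding set_integrable_def using fin \<Omega>
        by (intro integrable_scaleR_left integrable_real_indicator) auto
      show "norm (w x * cnj (w x - v x)) \<le> norm w * e" for x
        unfolding norm_mult complex_mod_cnj by (rule mult_mono[OF bd near norm_ge_zero norm_ge_zero])
    qed (rule set_integrable_norm[OF id])
    also have "\<dots> = e * (norm w * measure lborel \<Omega>)"
      using \<Omega> fin by (simp add: set_lebesgue_integral_def)
    finally show ?thesis .
  qed
  define M where "M = norm w * measure lborel \<Omega>"
  have "I = 0"
  proof (rule ccontr)
    assume "I \<noteq> 0"
    have M: "M \<ge> 0" by (simp add: M_def)
    have "\<bar>I\<bar> / (M + 1) > 0" using \<open>I \<noteq> 0\<close> M by simp
    then have "\<bar>I\<bar> \<le> \<bar>I\<bar> / (M + 1) * M"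
      unfolding M_def by (rule bound)
    also have "\<dots> < \<bar>I\<bar>" using \<open>I \<noteq> 0\<close> M by (simp add: divide_simps)
    finally show False by simp
  qed
  have [measurable]: "apply_bcontfun w \<in> borel_measurable borel" "\<Omega> \<in> sets borel"
    using \<Omega> by (auto intro: borel_measurable_continuous_onI)
  have "set_integrable lborel \<Omega> (\<lambda>x. norm (w x * cnj (w x)))"
    by (rule set_integrable_norm[OF intsq])
  then have "integrable lborel (\<lambda>x. indicator \<Omega> x *\<^sub>R (norm (w x))\<^sup>2)"
    by (simp add: set_integrable_def norm_mult power2_eq_square)
  then have "AE x in lborel. indicator \<Omega> x *\<^sub>R (norm (w x))\<^sup>2 = 0"
    using \<open>I = 0\<close> unfolding I_def set_lebesgue_integral_def
    by (subst (asm) integral_nonneg_eq_0_iff_AE) auto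
  then have ae: "AE x in lborel. x \<notin> {x\<in>\<Omega>. w x \<noteq> 0}"
    by eventually_elim (auto simp: indicator_def)
  have "open (\<Omega> \<inter> {x. w x \<noteq> 0})"
    using \<Omega> by (intro open_Int open_Collect_neq) auto
  then have op: "open {x\<in>\<Omega>. w x \<noteq> 0}" by (simp add: Collect_conj_eq)
  have "{x\<in>\<Omega>. w x \<noteq> 0} \<in> null_sets lborel"
    using ae op by (subst AE_iff_null_sets) auto
  then have "{x\<in>\<Omega>. w x \<noteq> 0} = {}"
    using op open_not_negligible negligible_iff_null_sets null_sets_completionI by blast
  then have "w1 x = w2 x" for x
    using C0_zero[OF C0(1), of x] C0_zero[OF C0(2), of x] by (cases "x \<in> \<Omega>") (auto simp: w_def)
  then show ?thesis by (rule bcontfun_eqI)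
qed

lemma dirichlet_laplacian_eqI:
  fixes u w :: "'a::euclidean_space \<Rightarrow>\<^sub>C complex"
  assumes "open \<Omega>" "bounded \<Omega>" "w \<in> C0 \<Omega>" "distr_laplacian \<Omega> u w"
  shows "dirichlet_laplacian \<Omega> u = w"
  unfolding dirichlet_laplacian_def using assms distr_laplacian_unique by (intro the_equality) blast+

end

theory Submission
  imports Defs
begin

text \<open>
  Each functional \<open>f \<mapsto> U f y\<close> is non-zero and disjointness preserving, hence a multiple of a point
  evaluation, so that \<open>U f = h \<cdot> (f \<circ> \<tau>)\<close>. Applying \<open>U\<close> to test functions that agree with a polynomial \<open>P\<close>
  near \<open>\<tau> y0\<close> shows that \<open>\<Delta> (h \<cdot> (P \<circ> \<tau>)) = h \<cdot> (\<Delta> P \<circ> \<tau>)\<close> near \<open>y0\<close>. For \<open>P = 1\<close> and for linear \<open>P\<close> the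
  left-hand side is harmonic, so \<open>h\<close> and \<open>\<tau>\<close> are differentiable; for \<open>P x = ((x - \<tau> y0) \<bullet> e)\<^sup>2\<close> the second
  order behaviour of mean values shows that the adjoint of the derivative of \<open>\<tau>\<close> preserves norms. As \<open>\<tau>\<close> is
  injective, invariance of domain makes the dimensions equal and \<open>\<tau>\<close> a local isometry, hence affine on
  components, and then \<open>h\<close> is locally constant. The image of a component of \<open>\<Omega>2\<close> is open and closed in \<open>\<Omega>1\<close>:
  at a point of \<open>\<Omega>1\<close> that is only reached from \<open>\<partial>\<Omega>2\<close>, every \<open>f \<in> C0 \<Omega>1\<close> would have to vanish.
\<close>

subsection \<open>Smooth functions\<close>

text \<open>The obstacle is regularity: \<open>U f\<close> is only continuous with a distributional
  Laplacian, so no chain rule applies to \<open>h\<close> or \<open>\<tau>\<close> at the outset.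
  Local information is read off from integrals of \<open>v (x + s z)\<close> against two fixed
  radial weights. The weights \<open>kernel 0\<close> and \<open>kernel 2\<close> are paired because
  the gradient of the former is -2 z times the latter; hence the s-derivative of the
  \<open>kernel 2\<close> mean of v is s/2 times the \<open>kernel 0\<close> mean of its Laplacian
  w. If w vanishes nearby, the means are constant and reproduce v by a smooth convolution. If v x =
  0, they behave like s^2/4 times w x times the mass of \<open>kernel 0\<close>. The second moments
  of \<open>kernel 2\<close> carry the same mass, so it cancels in the comparison.

  Polynomials live on the side of \<open>\<Omega>1\<close>, so this comparison first controls the
  adjoint of the derivative; orthogonality needs equal dimensions as well. The derivative of
  \<open>\<tau>\<close> is not known to be continuous, so local isometry comes from a homeomorphism
  whose derivative and inverse derivative both have norm at most 1, by the mean value inequality in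
  both directions.\<close>

definition smooth :: "('a::euclidean_space \<Rightarrow> complex) \<Rightarrow> bool" where
  "smooth f \<longleftrightarrow> (\<forall>k. Ck_on k UNIV f)"

lemma partial_eq:
  assumes "(f has_derivative D) (at x)"
  shows "partial i f x = D i"
  unfolding partial_def using assms by (metis frechet_derivative_at)

text \<open>Supplies all first partials from one derivative family \<open>D\<close>, so that the
  inductions below can feed in the standard derivative rules for sums, products and
  inverses.\<close>

lemma Ck_SucI:
  assumes "\<And>x. (f has_derivative D x) (at x)" "\<And>i. i \<in> Basis \<Longrightarrow> Ck_on k UNIV (\<lambda>x. D x i)"
  shows "Ck_on (Suc k) UNIV f"
proof -
  have "partial i f = (\<lambda>x. D x i)" for i
    using partial_eq[OF assms(1)] by auto
  then show ?thesis using assms by (auto simp: differentiable_def)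
qed

lemma Ck_has_derivative:
  assumes "Ck_on (Suc k) UNIV f"
  shows "(f has_derivative frechet_derivative f (at x)) (at x)"
  using assms by (auto simp: frechet_derivative_works[symmetric])

lemma Ck_pred: "Ck_on (Suc k) UNIV f \<Longrightarrow> Ck_on k UNIV f"
proof (induction k arbitrary: f)
  case 0
  then show ?case
    by (auto intro!: differentiable_imp_continuous_on simp: differentiable_on_def differentiable_at_withinI)
next
  case (Suc k)
  then show ?case by (metis Ck_on.simps(2))
qed

lemma Ck_const: "Ck_on k UNIV (\<lambda>x. c)"
  by (induction k arbitrary: c) (auto simp del: Ck_on.simps(2) simp: continuous_on_const
      intro!: Ck_SucI[where D="\<lambda>x h. 0"] has_derivative_const)

lemma Ck_add: "Ck_on k UNIV f \<Longrightarrow> Ck_on k UNIV g \<Longrightarrow> Ck_on k UNIV (\<lambda>x. f x + g x)"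
proof (induction k arbitrary: f g)
  case (Suc k)
  show ?case
    by (rule Ck_SucI[OF has_derivative_add[OF Suc.prems[THEN Ck_has_derivative]]])
       (use Suc in \<open>auto simp: partial_def[symmetric]\<close>)
qed (auto intro: continuous_on_add)

lemma Ck_mult: "Ck_on k UNIV f \<Longrightarrow> Ck_on k UNIV g \<Longrightarrow> Ck_on k UNIV (\<lambda>x. f x * g x)"
proof (induction k arbitrary: f g)
  case (Suc k)
  show ?case
    by (rule Ck_SucI[OF has_derivative_mult[OF Suc.prems[THEN Ck_has_derivative]]])
       (use Suc Ck_pred[OF Suc.prems(1)] Ck_pred[OF Suc.prems(2)]
         in \<open>auto simp: partial_def[symmetric] intro!: Ck_add\<close>)
qed (auto intro: continuous_on_mult)

lemma Ck_inverse: "Ck_on k UNIV f \<Longrightarrow> (\<And>x. f x \<noteq> 0) \<Longrightarrow> Ck_on k UNIV (\<lambda>x. inverse (f x))"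
proof (induction k)
  case (Suc k)
  have 1: "Ck_on k UNIV (\<lambda>x. inverse (f x))" using Suc Ck_pred[OF Suc.prems(1)] by blast
  have "Ck_on k UNIV (\<lambda>x. (- 1) * (inverse (f x) * partial i f x * inverse (f x)))"
    if "i \<in> Basis" for i
    using that Suc.prems(1) by (intro Ck_mult Ck_const 1) auto
  then show ?case
    by (intro Ck_SucI[OF Deriv.has_derivative_inverse[OF Suc.prems(2) Ck_has_derivative[OF Suc.prems(1)]]])
       (auto simp: partial_def)
qed (auto intro: continuous_on_inverse)

lemma Ck_inner: "Ck_on k UNIV (\<lambda>x. complex_of_real ((x - a) \<bullet> b))"
  by (cases k) (auto simp del: Ck_on.simps(2) intro!: continuous_intros 
      Ck_SucI[where D="\<lambda>x h. complex_of_real (h \<bullet> b)"] Ck_const derivative_eq_intros)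

lemma smooth_const: "smooth (\<lambda>x. c)" by (simp add: smooth_def Ck_const)
lemma smooth_add: "smooth f \<Longrightarrow> smooth g \<Longrightarrow> smooth (\<lambda>x. f x + g x)" by (simp add: smooth_def Ck_add)
lemma smooth_mult: "smooth f \<Longrightarrow> smooth g \<Longrightarrow> smooth (\<lambda>x. f x * g x)" by (simp add: smooth_def Ck_mult)
lemma smooth_inverse: "smooth f \<Longrightarrow> (\<And>x. f x \<noteq> 0) \<Longrightarrow> smooth (\<lambda>x. inverse (f x))"
  by (simp add: smooth_def Ck_inverse)
lemma smooth_inner: "smooth (\<lambda>x. complex_of_real ((x - a) \<bullet> b))" by (simp add: smooth_def Ck_inner)
lemma smooth_diff: "smooth f \<Longrightarrow> smooth g \<Longrightarrow> smooth (\<lambda>x. f x - g x)" by (simp add: smooth_def Ck_diff)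
lemma smooth_sum: "(\<And>i. i \<in> A \<Longrightarrow> smooth (f i)) \<Longrightarrow> smooth (\<lambda>x. \<Sum>i\<in>A. f i x)"
  by (induction A rule: infinite_finite_induct) (auto intro: smooth_const smooth_add)
lemma smooth_partial: "smooth f \<Longrightarrow> i \<in> Basis \<Longrightarrow> smooth (partial i f)"
  unfolding smooth_def using Ck_on.simps(2) by blast
lemma smooth_laplacian: "smooth f \<Longrightarrow> smooth (laplacian f)"
  unfolding laplacian_def[abs_def] by (intro smooth_sum smooth_partial)
lemma smooth_continuous: "smooth f \<Longrightarrow> continuous_on S f"
  unfolding smooth_def using Ck_on.simps(1) continuous_on_subset by blast
lemma smooth_has_derivative: "smooth f \<Longrightarrow> (f has_derivative frechet_derivative f (at x)) (at x)"
  unfolding smooth_def using Ck_has_derivative by blast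

lemma partial_mult:
  assumes "smooth f" "smooth g"
  shows "partial i (\<lambda>x. f x * g x) x = partial i f x * g x + f x * partial i g x"
  by (subst partial_eq[OF has_derivative_mult[OF assms[THEN smooth_has_derivative]]])
     (simp add: partial_def algebra_simps)

text \<open>Differentiability is not assumed: both functions have exactly the same derivatives at
  \<open>x\<close>, so the choice inside \<open>frechet_derivative\<close> is the same for
  both.\<close>

lemma partial_cong_open:
  assumes "open S" "x \<in> S" "\<And>y. y \<in> S \<Longrightarrow> f y = g y"
  shows "partial i f x = partial i g x"
proof -
  have "(f has_derivative D) (at x) \<longleftrightarrow> (g has_derivative D) (at x)" for D
    using assms has_derivative_transform_within_open[of f D x UNIV S g]
      has_derivative_transform_within_open[of g D x UNIV S f] by auto
  then show ?thesis by (simp add: partial_def frechet_derivative_def)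
qed

lemma laplacian_cong_open:
  assumes "open S" "x \<in> S" "\<And>y. y \<in> S \<Longrightarrow> f y = g y"
  shows "laplacian f x = laplacian g x"
  unfolding laplacian_def
  by (intro sum.cong refl partial_cong_open[OF assms(1,2)]) (use assms partial_cong_open in blast)

text \<open>Dividing by powers of \<open>s\<close> makes the family closed under differentiation.\<close>

definition bump :: "nat \<Rightarrow> real \<Rightarrow> real" where
  "bump m s = (if s > 0 then exp (- 1 / s) / s ^ m else 0)"

lemma bump_nonneg: "0 \<le> bump m s" by (simp add: bump_def)
lemma bump_pos: "0 < s \<Longrightarrow> 0 < bump m s" by (simp add: bump_def)
lemma bump_zero: "s \<le> 0 \<Longrightarrow> bump m s = 0" by (simp add: bump_def)

text \<open>Substituting t = 1/s turns the right-hand limit into t^m / exp t at infinity; from the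
  left the function is zero.\<close>

lemma bump_tendsto_0: "(bump m \<longlongrightarrow> 0) (at 0)"
proof -
  have "((\<lambda>t::real. t ^ m / exp t) \<longlongrightarrow> 0) at_top" by (rule tendsto_power_div_exp_0)
  then have "((\<lambda>s::real. (inverse s) ^ m / exp (inverse s)) \<longlongrightarrow> 0) (at_right 0)"
    using filterlim_compose filterlim_inverse_at_top_right by blast
  moreover have "\<forall>\<^sub>F s in at_right (0::real). (inverse s) ^ m / exp (inverse s) = bump m s"
    unfolding eventually_at_right_field
    by (intro exI[of _ 1]) (auto simp: bump_def exp_minus field_simps)
  ultimately have R: "(bump m \<longlongrightarrow> 0) (at_right 0)" by (rule Lim_transform_eventually)
  have "\<forall>\<^sub>F s in at_left (0::real). 0 = bump m s"
    unfolding eventually_at_left_field by (intro exI[of _ "-1"]) (auto simp: bump_def)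
  then have "(bump m \<longlongrightarrow> 0) (at_left 0)" by (rule Lim_transform_eventually[OF tendsto_const])
  with R show ?thesis by (simp add: filterlim_at_split)
qed

lemma bump_deriv: "(bump m has_real_derivative (bump (m + 2) s - m * bump (m + 1) s)) (at s)"
proof (cases "s = 0")
  case True
  \<comment> \<open>Dividing by the increment raises the index by one, so the difference quotient at
    0 is again a member of the family.\<close>
  have "(\<lambda>h. (bump m (0 + h) - bump m 0) / h) = bump (Suc m)"
    by (auto simp: bump_def fun_eq_iff)
  then have "(bump m has_real_derivative 0) (at 0)"
    unfolding DERIV_def using bump_tendsto_0 by simp
  then show ?thesis using True by (simp add: bump_zero)
next
  case False
  then consider "s > 0" | "s < 0" by linarith
  then show ?thesis
  proof cases
    case 1
    have "((\<lambda>s. exp (- 1 / s) / s ^ m) has_real_derivative (bump (m + 2) s - m * bump (m + 1) s)) (at s)"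
    proof (cases m)
      case 0
      then show ?thesis using 1
        by (auto intro!: derivative_eq_intros simp: bump_def power2_eq_square field_simps)
    next
      case (Suc n)
      have "real n * s ^ n = real n * (s * s ^ (n - Suc 0))" by (cases n) auto
      then show ?thesis using 1 Suc
        by (auto intro!: derivative_eq_intros simp: bump_def power2_eq_square field_simps)
    qed
    then show ?thesis
      by (rule has_field_derivative_transform_within_open[where S="{0<..}"])
        (use 1 in \<open>auto simp: bump_def\<close>)
  next
    case 2
    have "((\<lambda>s. 0) has_real_derivative (bump (m + 2) s - m * bump (m + 1) s)) (at s)"
      using 2 by (auto simp: bump_def)
    then show ?thesis 
      by (rule has_field_derivative_transform_within_open[where S="{..<0}"])
        (use 2 in \<open>auto simp: bump_def\<close>)
  qed
qed

lemma continuous_bump: "continuous_on S (bump m)"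
  by (meson DERIV_continuous bump_deriv continuous_at_imp_continuous_on)

lemmas continuous_on_bump [continuous_intros] = continuous_on_compose2[OF continuous_bump[of UNIV] _ subset_UNIV]

lemma bump_measurable [measurable]: "bump m \<in> borel_measurable borel"
  by (rule borel_measurable_continuous_onI[OF continuous_bump])

lemma bump_radial_deriv:
  fixes a :: "'a::euclidean_space"
  shows "((\<lambda>x. bump m (s - c * ((x - a) \<bullet> (x - a)))) has_derivative
     (\<lambda>h. (bump (m + 2) (s - c * ((x - a) \<bullet> (x - a))) - m * bump (m + 1) (s - c * ((x - a) \<bullet> (x - a)))) *
          (- 2 * c * ((x - a) \<bullet> h)))) (at x)"
proof -
  let ?q = "\<lambda>x. s - c * ((x - a) \<bullet> (x - a))"
  have "(?q has_derivative (\<lambda>h. - 2 * c * ((x - a) \<bullet> h))) (at x)"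
    by (auto intro!: derivative_eq_intros simp: inner_commute algebra_simps)
  from has_derivative_compose[OF this bump_deriv[unfolded has_field_derivative_def]]
  show ?thesis .
qed

text \<open>Each partial derivative is a combination of radial bumps of index \<open>m + 2\<close>
  and \<open>m + 1\<close>, times an affine function. The induction on the order therefore closes
  once \<open>m\<close> is arbitrary.\<close>

lemma smooth_bump:
  fixes a :: "'a::euclidean_space"
  shows "smooth (\<lambda>x. complex_of_real (bump m (s - c * ((x - a) \<bullet> (x - a)))))"
  unfolding smooth_def
proof
  fix k
  show "Ck_on k UNIV (\<lambda>x. complex_of_real (bump m (s - c * ((x - a) \<bullet> (x - a)))))"
  proof (induction k arbitrary: m)
    case 0
    then show ?case by (auto intro!: continuous_intros)
  next
    case (Suc k)
    let ?b = "\<lambda>m x. complex_of_real (bump m (s - c * ((x - a) \<bullet> (x - a))))"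
    have "Ck_on k UNIV (\<lambda>x. (?b (m + 2) x + (- of_nat m) * ?b (m + 1) x) *
        (of_real (- 2 * c) * of_real ((x - a) \<bullet> i)))" for i
      by (intro Ck_mult Ck_add Ck_const Ck_inner Suc)
    then show ?case
      by (intro Ck_SucI[OF has_derivative_of_real[OF bump_radial_deriv]]) simp
  qed
qed

text \<open>The cutoff is A / (A + B), where \<open>A\<close> is positive exactly inside the large
  ball and \<open>B\<close> exactly outside the small closed one. Since r < R they never vanish
  together.\<close>

lemma smooth_cutoff:
  fixes a :: "'a::euclidean_space"
  assumes "0 < r" "r < R"
  obtains \<psi> :: "'a \<Rightarrow> complex" where "smooth \<psi>" "\<And>x. x \<in> cball a r \<Longrightarrow> \<psi> x = 1"
    "\<And>x. x \<notin> ball a R \<Longrightarrow> \<psi> x = 0" "\<And>x. norm (\<psi> x) \<le> 1" "\<And>x. norm (1 - \<psi> x) \<le> 1"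
proof -
  define A where "A x = bump 0 (1 - (1/R\<^sup>2) * ((x - a) \<bullet> (x - a)))" for x
  \<comment> \<open>The signs of both parameters are reversed: the argument is |x - a|^2 / r^2 - 1,
    positive outside radius \<open>r\<close>.\<close>
  define B where "B x = bump 0 (-1 - (-1/r\<^sup>2) * ((x - a) \<bullet> (x - a)))" for x
  have A0: "A x = 0" if "x \<notin> ball a R" for x
  proof -
    have "R \<le> norm (x - a)" using that by (auto simp: dist_norm norm_minus_commute)
    then have "R\<^sup>2 \<le> (x - a) \<bullet> (x - a)" using assms by (auto simp: power2_norm_eq_inner[symmetric] intro!: power_mono)
    then show ?thesis unfolding A_def using assms by (intro bump_zero) (simp add: field_simps)
  qed
  have A1: "A x > 0" if "norm (x - a) < R" for x
  proof -
    have "(x - a) \<bullet> (x - a) < R\<^sup>2" using that assms by (auto simp: power2_norm_eq_inner[symmetric] intro!: power_strict_mono)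
    then show ?thesis unfolding A_def using assms by (intro bump_pos) (simp add: field_simps)
  qed
  have B0: "B x = 0" if "x \<in> cball a r" for x
  proof -
    have "norm (x - a) \<le> r" using that by (auto simp: dist_norm norm_minus_commute)
    then have "(x - a) \<bullet> (x - a) \<le> r\<^sup>2" using assms by (auto simp: power2_norm_eq_inner[symmetric] intro!: power_mono)
    then show ?thesis unfolding B_def using assms by (intro bump_zero) (simp add: field_simps)
  qed
  have B1: "B x > 0" if "r < norm (x - a)" for x
  proof -
    have "(x - a) \<bullet> (x - a) > r\<^sup>2" using that assms by (auto simp: power2_norm_eq_inner[symmetric] intro!: power_strict_mono)
    then show ?thesis unfolding B_def using assms by (intro bump_pos) (simp add: field_simps)
  qed
  have nn: "A x \<ge> 0" "B x \<ge> 0" for x by (auto simp: A_def B_def bump_nonneg)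
  have pos: "A x + B x > 0" for x
    using A1[of x] B1[of x] nn[of x] assms by linarith
  define \<psi> where "\<psi> x = complex_of_real (A x) * inverse (of_real (A x) + of_real (B x))" for x
  have sA: "smooth (\<lambda>x. complex_of_real (A x))" "smooth (\<lambda>x. complex_of_real (B x))"
    unfolding A_def B_def by (rule smooth_bump)+
  have chi: "\<psi> x = of_real (A x / (A x + B x))" for x by (simp add: \<psi>_def divide_inverse)
  have ne: "complex_of_real (A x) + of_real (B x) \<noteq> 0" for x
    using pos[of x] by (metis of_real_add of_real_eq_0_iff less_irrefl)
  show ?thesis
  proof
    show "smooth \<psi>" unfolding \<psi>_def[abs_def]
      by (intro smooth_mult smooth_inverse smooth_add sA ne)
    show "\<psi> x = 1" if "x \<in> cball a r" for x
      using B0[OF that] pos[of x] by (simp add: chi)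
    show "\<psi> x = 0" if "x \<notin> ball a R" for x
      using A0[OF that] by (simp add: chi)
    show "norm (\<psi> x) \<le> 1" for x
      using pos[of x] nn[of x] unfolding chi norm_of_real by simp
    show "norm (1 - \<psi> x) \<le> 1" for x
    proof -
      have "1 - A x / (A x + B x) = B x / (A x + B x)" using pos[of x] by (simp add: field_simps)
      then have "1 - \<psi> x = of_real (B x / (A x + B x))"
        unfolding chi by (metis of_real_1 of_real_diff)
      moreover have "\<bar>B x / (A x + B x)\<bar> \<le> 1" using pos[of x] nn[of x] by simp
      ultimately show ?thesis by (metis norm_of_real)
    qed
  qed
qed

subsection \<open>Test functions\<close>

lemma test_functionsI:
  assumes "smooth f" "compact K" "K \<subseteq> \<Omega>" "\<And>x. x \<notin> K \<Longrightarrow> f x = 0"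
  shows "f \<in> test_functions \<Omega>"
proof -
  have "{x. f x \<noteq> 0} \<subseteq> K" using assms(4) by auto
  then have *: "closure {x. f x \<noteq> 0} \<subseteq> K"
    using assms(2) by (simp add: closure_minimal compact_imp_closed)
  then have "compact (closure {x. f x \<noteq> 0})"
    using compact_Int_closed[OF assms(2) closed_closure, of "{x. f x \<noteq> 0}"] by (simp add: inf.absorb2)
  then show ?thesis using * assms by (auto simp: test_functions_def smooth_def)
qed

lemma test_smooth: "f \<in> test_functions \<Omega> \<Longrightarrow> smooth f"
  by (simp add: test_functions_def smooth_def)

lemma test_support:
  assumes "f \<in> test_functions \<Omega>"
  obtains K where "compact K" "K \<subseteq> \<Omega>" "\<And>x. x \<notin> K \<Longrightarrow> f x = 0"
proof
  show "compact (closure {x. f x \<noteq> 0})" "closure {x. f x \<noteq> 0} \<subseteq> \<Omega>"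
    using assms by (auto simp: test_functions_def)
  show "f x = 0" if "x \<notin> closure {x. f x \<noteq> 0}" for x
    using that closure_subset[of "{x. f x \<noteq> 0}"] by auto
qed

lemma test_mult: 
  assumes "f \<in> test_functions \<Omega>" "smooth g"
  shows "(\<lambda>x. f x * g x) \<in> test_functions \<Omega>"
proof -
  obtain K where "compact K" "K \<subseteq> \<Omega>" "\<And>x. x \<notin> K \<Longrightarrow> f x = 0"
    using test_support[OF assms(1)] by blast
  then show ?thesis
    using assms by (intro test_functionsI[of _ K]) (auto intro: smooth_mult test_smooth)
qed

lemma test_add:
  assumes "f \<in> test_functions \<Omega>" "g \<in> test_functions \<Omega>"
  shows "(\<lambda>x. f x + g x) \<in> test_functions \<Omega>"
proof -
  obtain K where "compact K" "K \<subseteq> \<Omega>" "\<And>x. x \<notin> K \<Longrightarrow> f x = 0"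
    using test_support[OF assms(1)] by blast
  moreover obtain L where "compact L" "L \<subseteq> \<Omega>" "\<And>x. x \<notin> L \<Longrightarrow> g x = 0"
    using test_support[OF assms(2)] by blast
  ultimately show ?thesis
    using assms by (intro test_functionsI[of _ "K \<union> L"]) (auto intro: smooth_add test_smooth compact_Un)
qed

lemma partial_const: "partial i (\<lambda>x. c) = (\<lambda>x. 0)"
  using partial_eq[OF has_derivative_const] by blast

lemma test_laplacian:
  assumes "f \<in> test_functions \<Omega>"
  shows "laplacian f \<in> test_functions \<Omega>"
proof -
  obtain K where K: "compact K" "K \<subseteq> \<Omega>" "\<And>x. x \<notin> K \<Longrightarrow> f x = 0"
    using test_support[OF assms] by blast
  have "laplacian f x = 0" if "x \<notin> K" for x
  proof -
    have "laplacian f x = laplacian (\<lambda>x. 0) x"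
      using that K by (intro laplacian_cong_open[of "- K"]) (auto simp: compact_imp_closed)
    also have "\<dots> = 0" 
      by (simp add: laplacian_def partial_const)
    finally show ?thesis .
  qed
  then show ?thesis
    by (rule test_functionsI[OF smooth_laplacian[OF test_smooth[OF assms]] K(1,2)])
qed

text \<open>Compact support makes the function bounded, so \<open>Bcontfun\<close> loses nothing.
  Products and cutoffs can thus be formed as plain functions and wrapped afterwards.\<close>

lemma test_bcontfun:
  assumes "f \<in> test_functions \<Omega>"
  shows "apply_bcontfun (Bcontfun f) = f"
proof -
  obtain K where K: "compact K" "\<And>x. x \<notin> K \<Longrightarrow> f x = 0" by (rule test_support[OF assms]) auto
  have c: "continuous_on S f" for S using assms test_smooth smooth_continuous by blast
  have "range f \<subseteq> insert 0 (f ` K)" using K by auto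
  then have "bounded (range f)"
    by (rule bounded_subset[rotated])
       (simp add: compact_imp_bounded[OF compact_continuous_image[OF c K(1)]])
  then have "f \<in> bcontfun" using c[of UNIV] unfolding bcontfun_def by blast
  then show ?thesis by (rule Bcontfun_inverse)
qed

lemma test_C0: "f \<in> test_functions \<Omega> \<Longrightarrow> Bcontfun f \<in> C0 \<Omega>"
  unfolding C0_def by (intro subsetD[OF closure_subset]) (simp add: test_bcontfun)

subsection \<open>Integrals of compactly supported functions\<close>

text \<open>The bridge from the Lebesgue integral of the distributional Laplacian to integrals over
  a box, the form used by the Leibniz rules for differentiating under the integral.\<close>

lemma
  fixes f :: "'a::euclidean_space \<Rightarrow> 'c::euclidean_space"
  assumes "continuous_on UNIV f" "\<And>x. x \<notin> cbox a b \<Longrightarrow> f x = 0"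
  shows integrable_compact_support: "integrable lborel f"
    and lint_eq_integral_cbox: "(LINT x|lborel. f x) = integral (cbox a b) f"
proof -
  have eq: "f = (\<lambda>x. indicator (cbox a b) x *\<^sub>R f x)"
    using assms(2) by (auto simp: indicator_def fun_eq_iff)
  have si: "set_integrable lborel (cbox a b) f"
    unfolding set_integrable_def
    by (rule borel_integrable_compact) (auto intro: continuous_on_subset[OF assms(1)])
  then show "integrable lborel f" unfolding set_integrable_def eq[symmetric] .
  have "(LINT x|lborel. f x) = (LINT x:cbox a b|lborel. f x)"
    unfolding set_lebesgue_integral_def eq[symmetric] ..
  also have "\<dots> = integral (cbox a b) f" by (rule set_borel_integral_eq_integral(2)[OF si])
  finally show "(LINT x|lborel. f x) = integral (cbox a b) f" .
qed

lemma integrable_compact_support':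
  fixes f :: "'a::euclidean_space \<Rightarrow> 'c::euclidean_space"
  assumes "continuous_on UNIV f" "bounded K" "\<And>x. x \<notin> K \<Longrightarrow> f x = 0"
  shows "integrable lborel f"
proof -
  obtain a where "K \<subseteq> cbox (- a) a" using bounded_subset_cbox_symmetric[OF assms(2)] by blast
  then show ?thesis using assms by (intro integrable_compact_support[of f "- a" a]) auto
qed

text \<open>Translation invariance: the integral of \<open>F (x + t *\<^sub>R v)\<close> does not
  depend on \<open>t\<close>, and its derivative at \<open>t = 0\<close> is the integral in
  question.\<close>

lemma lint_directional_derivative:
  fixes F :: "'a::euclidean_space \<Rightarrow> 'c::euclidean_space"
  assumes D: "\<And>x. (F has_derivative D x) (at x)" and cD: "continuous_on UNIV (\<lambda>x. D x v)"
    and K: "compact K" "\<And>x. x \<notin> K \<Longrightarrow> F x = 0"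
  shows "(LINT x|lborel. D x v) = 0"
proof -
  have cF: "continuous_on UNIV F"
    using D by (meson continuous_at_imp_continuous_on has_derivative_continuous)
  have D0: "D x v = 0" if "x \<notin> K" for x
  proof -
    have "(F has_derivative (\<lambda>h. 0)) (at x)"
      by (rule has_derivative_transform_within_open[OF has_derivative_const, of "- K" x 0])
         (use K that in \<open>auto simp: compact_imp_closed\<close>)
    with D[of x] show ?thesis by (metis has_derivative_unique)
  qed
  obtain M where M: "\<And>x. x \<in> K \<Longrightarrow> norm x \<le> M"
    using compact_imp_bounded[OF K(1)] unfolding bounded_iff by auto
  \<comment> \<open>All translates with |t| at most 1 have to be supported in one box; enlarging the
    radius \<open>M\<close> of \<open>K\<close> by \<open>norm v\<close> achieves this.\<close>
  obtain c where c: "cball (0::'a) (M + norm v) \<subseteq> cbox (- c) c"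
    using bounded_subset_cbox_symmetric[OF bounded_cball] by metis
  have out: "x + t *\<^sub>R v \<notin> K" if "x \<notin> cbox (- c) c" "\<bar>t\<bar> \<le> 1" for x t
  proof
    assume "x + t *\<^sub>R v \<in> K"
    then have "norm (x + t *\<^sub>R v) \<le> M" by (rule M)
    moreover have "norm x \<le> norm (x + t *\<^sub>R v) + norm (t *\<^sub>R v)"
      using norm_triangle_ineq4[of "x + t *\<^sub>R v" "t *\<^sub>R v"] by simp
    moreover have "norm (t *\<^sub>R v) \<le> norm v" using that(2) by (simp add: mult_left_le_one_le)
    ultimately have "x \<in> cball 0 (M + norm v)" by simp
    with c that(1) show False by blast
  qed
  have out0: "x \<notin> K" if "x \<notin> cbox (- c) c" for x
    using out[OF that, of 0] by simp
  have cont: "continuous_on UNIV (\<lambda>x. F (x + t *\<^sub>R v))" for t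
    by (intro continuous_on_compose2[OF cF] continuous_intros) auto
  have "integral (cbox (- c) c) (\<lambda>x. F (x + t *\<^sub>R v)) = integral (cbox (- c) c) F"
    if "t \<in> {-1..1}" for t
  proof -
    have [measurable]: "F \<in> borel_measurable borel" by (rule borel_measurable_continuous_onI[OF cF])
    have "integral (cbox (- c) c) (\<lambda>x. F (x + t *\<^sub>R v)) = (LINT x|lborel. F (x + t *\<^sub>R v))"
      by (rule lint_eq_integral_cbox[symmetric, OF cont]) (use out K that in auto)
    also have "\<dots> = (LINT x|distr lborel borel ((+) (t *\<^sub>R v)). F x)"
      by (subst integral_distr) (auto simp: add.commute)
    also have "\<dots> = (LINT x|lborel. F x)" by (simp add: lborel_distr_plus)
    also have "\<dots> = integral (cbox (- c) c) F"
      by (rule lint_eq_integral_cbox[OF cF]) (use out0 K in auto)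
    finally show ?thesis .
  qed
  moreover have "((\<lambda>t. integral (cbox (- c) c) (\<lambda>x. F (x + t *\<^sub>R v))) has_vector_derivative
      integral (cbox (- c) c) (\<lambda>x. D (x + 0 *\<^sub>R v) v)) (at 0 within {-1..1})"
  proof (rule leibniz_rule_vector_derivative[where U="{-1..1}"])
    fix t :: real and x
    have "((\<lambda>t. F (x + t *\<^sub>R v)) has_derivative (\<lambda>h. D (x + t *\<^sub>R v) (h *\<^sub>R v))) (at t)"
      by (rule has_derivative_compose[OF _ D]) (auto intro!: derivative_eq_intros)
    moreover have "D (x + t *\<^sub>R v) (h *\<^sub>R v) = h *\<^sub>R D (x + t *\<^sub>R v) v" for h
      using D has_derivative_linear linear_cmul by blast
    ultimately show "((\<lambda>t. F (x + t *\<^sub>R v)) has_vector_derivative D (x + t *\<^sub>R v) v) (at t within {-1..1})"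
      by (simp add: has_vector_derivative_def has_derivative_at_withinI)
  next
    show "(\<lambda>x. F (x + t *\<^sub>R v)) integrable_on cbox (- c) c" for t
      by (rule integrable_continuous) (use cont continuous_on_subset in blast)
    show "continuous_on ({-1..1} \<times> cbox (- c) c) (\<lambda>(t, x). D (x + t *\<^sub>R v) v)"
      unfolding split_beta by (intro continuous_on_compose2[OF cD] continuous_intros) auto
  qed auto
  ultimately have 1: "((\<lambda>t. integral (cbox (- c) c) F) has_vector_derivative
      integral (cbox (- c) c) (\<lambda>x. D x v)) (at 0 within {-1..1})"
    by (auto elim!: has_vector_derivative_transform[rotated -1])
  have 2: "((\<lambda>t. integral (cbox (- c) c) F) has_vector_derivative 0) (at 0 within {-1..1})"
    by (rule has_vector_derivative_const)
  have "integral (cbox (- c) c) (\<lambda>x. D x v) = 0"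
    using vector_derivative_unique_within_closed_interval[OF _ _ 1[folded box_real(2)] 2[folded box_real(2)]] by simp
  then show ?thesis
    using lint_eq_integral_cbox[OF cD, of "- c" c] D0 out0 by auto
qed

lemma set_lint_supported:
  fixes f :: "'a::euclidean_space \<Rightarrow> 'c::euclidean_space"
  assumes "\<And>x. x \<notin> \<Omega> \<Longrightarrow> f x = 0"
  shows "(LINT x:\<Omega>|lborel. f x) = (LINT x|lborel. f x)"
  unfolding set_lebesgue_integral_def
  by (rule Bochner_Integration.integral_cong) (use assms in \<open>auto simp: indicator_def\<close>)

text \<open>Green's second identity: f times the Laplacian of g, minus g times that of f, is the
  divergence of the field \<open>F\<close> below, which inherits the compact support of
  \<open>f\<close>. Each of its partial derivatives integrates to zero.\<close>

lemma distr_laplacian_test: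
  assumes f: "f \<in> test_functions \<Omega>"
  shows "distr_laplacian \<Omega> f (laplacian f)"
  unfolding distr_laplacian_def
proof
  fix g :: "'a \<Rightarrow> complex" assume g: "g \<in> test_functions \<Omega>"
  obtain K where K: "compact K" "K \<subseteq> \<Omega>" "\<And>x. x \<notin> K \<Longrightarrow> f x = 0" by (rule test_support[OF f]) auto
  note sf = test_smooth[OF f] and sg = test_smooth[OF g]
  have oK: "open (- K)" using K(1) by (simp add: compact_imp_closed open_Compl)
  have pf: "partial i f x = 0" if "x \<notin> K" for x i
    using partial_cong_open[OF oK, of x f "\<lambda>x. 0"] K that by (simp add: partial_const)
  have lf: "laplacian f x = 0" if "x \<notin> K" for x
    using laplacian_cong_open[OF oK, of x f "\<lambda>x. 0"] K that
    by (simp add: laplacian_def partial_const)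
  define F where "F i x = f x * partial i g x - partial i f x * g x" for i x
  have sF: "smooth (F i)" if "i \<in> Basis" for i
    unfolding F_def[abs_def] using that by (intro smooth_diff smooth_mult sf sg smooth_partial)
  have ppf: "partial i (partial i f) x = 0" if "x \<notin> K" for x i
    using partial_cong_open[OF oK, of x "partial i f" "\<lambda>x. 0"] pf that by (simp add: partial_const)
  have pF: "partial i (F i) x = f x * partial i (partial i g) x - partial i (partial i f) x * g x"
    if "i \<in> Basis" for i x
  proof -
    have d: "(\<lambda>x. f x * partial i g x) differentiable (at x)" "(\<lambda>x. partial i f x * g x) differentiable (at x)" for x
      using that sf sg by (auto intro!: differentiableI smooth_has_derivative smooth_mult smooth_partial)
    show ?thesis unfolding F_def[abs_def] using that sf sg d
      by (simp add: partial_diff partial_mult smooth_partial)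
  qed
  have "0 = (\<Sum>i\<in>Basis. (LINT x|lborel. partial i (F i) x))"
  proof (rule sum.neutral[symmetric], rule ballI)
    fix i :: 'a assume i: "i \<in> Basis"
    show "(LINT x|lborel. partial i (F i) x) = 0"
      unfolding partial_def
    proof (rule lint_directional_derivative[OF smooth_has_derivative[OF sF[OF i]] _ K(1)])
      show "continuous_on UNIV (\<lambda>x. frechet_derivative (F i) (at x) i)"
        using smooth_continuous[OF smooth_partial[OF sF[OF i] i], of UNIV] by (simp add: partial_def[abs_def])
      show "F i x = 0" if "x \<notin> K" for x using that K pf by (simp add: F_def)
    qed
  qed
  also have "\<dots> = (LINT x|lborel. (\<Sum>i\<in>Basis. partial i (F i) x))"
    by (rule Bochner_Integration.integral_sum[symmetric], rule integrable_compact_support'[OF _ compact_imp_bounded[OF K(1)]])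
       (auto simp: smooth_continuous smooth_partial sF pF[symmetric], simp add: pF ppf K(3))
  also have "\<dots> = (LINT x|lborel. f x * laplacian g x - laplacian f x * g x)"
    by (intro Bochner_Integration.integral_cong refl)
       (simp add: pF laplacian_def sum_subtractf sum_distrib_left sum_distrib_right)
  also have "\<dots> = (LINT x|lborel. f x * laplacian g x) - (LINT x|lborel. laplacian f x * g x)"
    by (rule Bochner_Integration.integral_diff; rule integrable_compact_support'[OF _ compact_imp_bounded[OF K(1)]])
       (use K lf in \<open>auto intro!: smooth_continuous smooth_mult smooth_laplacian sf sg\<close>)
  finally have "(LINT x|lborel. f x * laplacian g x) = (LINT x|lborel. laplacian f x * g x)" by simp
  then show "(LINT x:\<Omega>|lborel. f x * laplacian g x) = (LINT x:\<Omega>|lborel. laplacian f x * g x)"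
    using K lf by (subst (1 2) set_lint_supported) auto
qed

lemma lint_affine:
  fixes f :: "'a::euclidean_space \<Rightarrow> 'c::euclidean_space"
  assumes [measurable]: "f \<in> borel_measurable borel" and "0 < s"
  shows "(LINT y|lborel. f y) = s ^ DIM('a) *\<^sub>R (LINT z|lborel. f (x + s *\<^sub>R z))"
  using assms(2) by (subst lborel_affine[of s x]) (simp_all add: integral_density integral_distr)

subsection \<open>Mean values of distributional solutions\<close>

abbreviation kernel :: "nat \<Rightarrow> 'a::euclidean_space \<Rightarrow> real" where
  "kernel m z \<equiv> bump m (1 - z \<bullet> z)"

abbreviation mass :: "'a::euclidean_space itself \<Rightarrow> nat \<Rightarrow> real" where
  "mass _ m \<equiv> (LINT z|(lborel :: 'a measure). kernel m z)"

text \<open>The mean is not normalised: its limit is \<open>v x\<close> times the mass of the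
  kernel. The radius sits in the argument of \<open>v\<close>, which keeps the weight fixed for
  limits in \<open>s\<close>; \<open>mean_rescale\<close> moves it into the kernel for
  differentiation in \<open>s\<close>.\<close>

definition mean :: "nat \<Rightarrow> ('a::euclidean_space \<Rightarrow> complex) \<Rightarrow> 'a \<Rightarrow> real \<Rightarrow> complex" where
  "mean m v x s = (LINT z|lborel. v (x + s *\<^sub>R z) * of_real (kernel m z))"

lemma kernel_zero: "z \<notin> cball 0 1 \<Longrightarrow> kernel m z = 0"
  by (intro bump_zero) (auto simp: power2_norm_eq_inner[symmetric] not_le intro!: one_le_power)

lemma kernel_zero_sphere: "z \<notin> ball 0 1 \<Longrightarrow> kernel m z = 0"
  by (intro bump_zero) (auto simp: power2_norm_eq_inner[symmetric] not_le intro!: one_le_power)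

lemma integrable_kernel:
  fixes f :: "'a::euclidean_space \<Rightarrow> 'c::euclidean_space"
  assumes "continuous_on UNIV f"
  shows "integrable lborel (\<lambda>z. kernel m z *\<^sub>R f z)"
  by (rule integrable_compact_support'[of _ "cball 0 1"])
     (auto intro!: continuous_intros assms simp: kernel_zero)

text \<open>The kernel is nonnegative and strictly positive on the open unit ball, which is not a
  null set.\<close>

lemma mass_pos: "0 < mass TYPE('a::euclidean_space) m"
proof -
  have i: "integrable lborel (\<lambda>z::'a. kernel m z)"
    using integrable_kernel[of "\<lambda>_. 1::real" m] by simp
  have "mass TYPE('a) m \<noteq> 0"
  proof
    assume "mass TYPE('a) m = 0"
    then have "AE z in lborel. kernel m (z::'a) = 0"
      using integral_nonneg_eq_0_iff_AE[OF i] by (simp add: bump_nonneg)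
    then have "AE z in lborel. z \<notin> ball (0::'a) 1"
    proof eventually_elim
      case (elim z)
      have "\<not> norm z < 1"
        using elim bump_pos[of "1 - z \<bullet> z" m] power_strict_mono[of "norm z" 1 2]
        by (auto simp: power2_norm_eq_inner[symmetric])
      then show ?case by simp
    qed
    then have "ball (0::'a) 1 \<in> null_sets lborel" by (subst AE_iff_null_sets) auto
    then show False
      using open_not_negligible[of "ball (0::'a) 1"] negligible_iff_null_sets null_sets_completionI by auto
  qed
  moreover have "0 \<le> mass TYPE('a) m" by (intro Bochner_Integration.integral_nonneg bump_nonneg)
  ultimately show ?thesis by simp
qed

text \<open>Both moments come from \<open>\<partial>\<^sub>b (kernel 0) = - 2 (z \<bullet> b) kernel 2\<close>.\<close>

lemma kernel0_deriv:
  "((\<lambda>z. kernel 0 z) has_derivative (\<lambda>h. - 2 * (x \<bullet> h) * kernel 2 x)) (at x)"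
  using bump_radial_deriv[of 0 1 1 0 x] by (simp add: numeral_2_eq_2 mult.commute)

lemma first_moment: "(LINT z|lborel. (z \<bullet> b) * kernel 2 z) = 0"
proof -
  have "(LINT z|lborel. - 2 * (z \<bullet> b) * kernel 2 z) = 0"
    by (rule lint_directional_derivative[OF kernel0_deriv _ compact_cball[of 0 1]])
       (auto intro!: continuous_intros simp: kernel_zero)
  then show ?thesis by (simp add: mult.assoc)
qed

lemma second_moment:
  fixes a b :: "'a::euclidean_space"
  shows "(LINT z|lborel. (z \<bullet> a) * (z \<bullet> b) * kernel 2 z) = (a \<bullet> b) / 2 * mass TYPE('a) 0"
proof -
  \<comment> \<open>In direction \<open>a\<close> this derivative is (a . b) kernel 0 - 2 (z . a) (z
    . b) kernel 2, whose integral vanishes.\<close>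
  have d: "((\<lambda>z. (z \<bullet> b) * kernel 0 z) has_derivative
      (\<lambda>h. (h \<bullet> b) * kernel 0 x - 2 * (x \<bullet> b) * (x \<bullet> h) * kernel 2 x)) (at x)" for x :: 'a
    by (rule derivative_eq_intros kernel0_deriv refl)+ (simp add: algebra_simps)
  have i: "integrable lborel (\<lambda>z::'a. (a \<bullet> b) * kernel 0 z)"
    using integrable_kernel[of "\<lambda>_. a \<bullet> b" 0] by (simp add: mult.commute)
  have j: "integrable lborel (\<lambda>z::'a. 2 * ((z \<bullet> a) * (z \<bullet> b) * kernel 2 z))"
    using integrable_kernel[of "\<lambda>z. (z \<bullet> a) * (z \<bullet> b)" 2]
    by (simp add: mult.commute continuous_intros)
  have "0 = (LINT x|lborel. (a \<bullet> b) * kernel 0 x - 2 * (x \<bullet> b) * (x \<bullet> a) * kernel 2 x)"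
    by (rule lint_directional_derivative[OF d _ compact_cball[of 0 1], symmetric])
       (auto intro!: continuous_intros simp: kernel_zero)
  also have "\<dots> = (LINT x|lborel. (a \<bullet> b) * kernel 0 x - 2 * ((x \<bullet> a) * (x \<bullet> b) * kernel 2 x))"
    by (simp add: algebra_simps)
  also have "\<dots> = (a \<bullet> b) * mass TYPE('a) 0 - 2 * (LINT z|lborel. (z \<bullet> a) * (z \<bullet> b) * kernel 2 z)"
    by (subst Bochner_Integration.integral_diff[OF i j]) simp
  finally show ?thesis by simp
qed

text \<open>The explicit form, with \<open>c\<close> equal to the inverse square of the radius, is
  what matches the radius derivative of the rescaled \<open>kernel 2\<close> term by term.\<close>

lemma laplacian_bump:
  fixes a :: "'a::euclidean_space"
  defines "Q \<equiv> \<lambda>c y. 1 - c * ((y - a) \<bullet> (y - a))"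
  shows "laplacian (\<lambda>y. of_real (bump 0 (Q c y))) y =
    of_real (4 * c\<^sup>2 * ((y - a) \<bullet> (y - a)) * (bump 4 (Q c y) - 2 * bump 3 (Q c y))
             - 2 * c * DIM('a) * bump 2 (Q c y))"
proof -
  have 1: "partial i (\<lambda>y. of_real (bump 0 (Q c y))) = (\<lambda>y. of_real (bump 2 (Q c y) * (- 2 * c * ((y - a) \<bullet> i))))" for i
  proof
    fix y
    show "partial i (\<lambda>y. of_real (bump 0 (Q c y))) y = of_real (bump 2 (Q c y) * (- 2 * c * ((y - a) \<bullet> i)))"
      unfolding Q_def
      by (subst partial_eq[OF has_derivative_of_real[OF bump_radial_deriv]]) (simp add: numeral_2_eq_2)
  qed
  have 2: "partial i (\<lambda>y. of_real (bump 2 (Q c y) * (- 2 * c * ((y - a) \<bullet> i)))) y =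
     of_real (4 * c\<^sup>2 * (((y - a) \<bullet> i) * ((y - a) \<bullet> i)) * (bump 4 (Q c y) - 2 * bump 3 (Q c y)) - 2 * c * bump 2 (Q c y))"
    if "i \<in> Basis" for i
  proof -
    have "((\<lambda>y. bump 2 (Q c y)) has_derivative
      (\<lambda>h. (bump 4 (Q c y) - 2 * bump 3 (Q c y)) * (- 2 * c * ((y - a) \<bullet> h)))) (at y)"
      using bump_radial_deriv[of 2 1 c a y] by (simp add: Q_def)
    moreover have "((\<lambda>y. - 2 * c * ((y - a) \<bullet> i)) has_derivative (\<lambda>h. - 2 * c * (h \<bullet> i))) (at y)"
      by (auto intro!: derivative_eq_intros)
    ultimately have "((\<lambda>y. bump 2 (Q c y) * (- 2 * c * ((y - a) \<bullet> i))) has_derivative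
      (\<lambda>h. bump 2 (Q c y) * (- 2 * c * (h \<bullet> i)) +
        (bump 4 (Q c y) - 2 * bump 3 (Q c y)) * (- 2 * c * ((y - a) \<bullet> h)) * (- 2 * c * ((y - a) \<bullet> i)))) (at y)"
      by (rule has_derivative_mult)
    from partial_eq[OF has_derivative_of_real[OF this], of i] show ?thesis
      using that by (simp add: power2_eq_square algebra_simps)
  qed
  show ?thesis
    unfolding laplacian_def 1
    by (simp only: 2 cong: sum.cong)
       (simp add: euclidean_inner[of "y - a" "y - a"] sum_subtractf sum_distrib_left sum_distrib_right
         flip: of_real_sum of_real_diff)
qed

lemma mean_rescale:
  fixes v :: "'a::euclidean_space \<Rightarrow> complex"
  assumes v: "continuous_on UNIV v" and s: "0 < s" 
  shows "s ^ DIM('a) *\<^sub>R mean m v x s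
    = (LINT y|lborel. v y * of_real (bump m (1 - (1 / s\<^sup>2) * ((y - x) \<bullet> (y - x)))))"
proof -
  have [measurable]: "v \<in> borel_measurable borel" by (rule borel_measurable_continuous_onI[OF v])
  show ?thesis
    unfolding mean_def
    by (subst lint_affine[OF _ s, of _ x]) (use s in \<open>simp_all add: power2_eq_square\<close>)
qed

lemma scaled_bump_zero:
  assumes "0 < s" "y \<notin> cball x s"
  shows "bump m (1 - (1 / s\<^sup>2) * ((y - x) \<bullet> (y - x))) = 0"
proof -
  have "s \<le> norm (y - x)" using assms by (auto simp: dist_norm norm_minus_commute)
  then have "s\<^sup>2 \<le> (y - x) \<bullet> (y - x)"
    using assms by (auto simp: power2_norm_eq_inner[symmetric] intro!: power_mono)
  then show ?thesis using assms by (intro bump_zero) (simp add: field_simps)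
qed

text \<open>Let b m s be \<open>bump m\<close> at 1 - |y - x|^2 / s^2. The s-derivative of s^(-d) b
  2 s is (s/2) s^(-d) times the y-Laplacian of b 0 s. The latter is a test function for s < R, so
  the distributional equation replaces \<open>v\<close> and this Laplacian by \<open>w\<close> and b
  0 s itself.\<close>

lemma mean_has_derivative:
  fixes v w :: "'a::euclidean_space \<Rightarrow> complex"
  assumes v: "continuous_on UNIV v" and w: "continuous_on UNIV w"
    and L: "distr_laplacian \<Omega> v w" and R: "ball x R \<subseteq> \<Omega>" and s: "0 < s" "s < R"
  shows "(mean 2 v x has_vector_derivative (s / 2) *\<^sub>R mean 0 w x s) (at s)"
proof -
  let ?d = "DIM('a)"
  define q where "q y = (y - x) \<bullet> (y - x)" for y
  have cq: "continuous_on S q" for S unfolding q_def by (intro continuous_intros)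
  have cv: "continuous_on S v" for S using v continuous_on_subset by blast
  define b where "b m t y = bump m (1 - (1 / t\<^sup>2) * q y)" for m t y
  have b0: "b m t y = 0" if "y \<notin> cball x t" "0 < t" for m t y
    using scaled_bump_zero[OF that(2,1)] by (simp add: b_def q_def)
  \<comment> \<open>Differentiating under the integral requires a box independent of the radius;
    this one serves all radii below \<open>R\<close>.\<close>
  obtain c d where cd: "ball x R \<subseteq> cbox c d" using bounded_subset_cbox_symmetric[OF bounded_ball] by metis
  have b0': "b m t y = 0" if "y \<notin> cbox c d" "0 < t" "t < R" for m t y
  proof (rule b0[OF _ that(2)])
    have "cball x t \<subseteq> ball x R" using that by auto
    then show "y \<notin> cball x t" using that(1) cd by blast
  qed
  have mean_eq: "mean 2 v x t = integral (cbox c d) (\<lambda>y. v y * of_real (b 2 t y / t ^ ?d))"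
    if "0 < t" "t < R" for t
  proof -
    have "mean 2 v x t = (1 / t ^ ?d) *\<^sub>R (t ^ ?d *\<^sub>R mean 2 v x t)" using that by simp
    also have "\<dots> = (1 / t ^ ?d) *\<^sub>R (LINT y|lborel. v y * of_real (b 2 t y))"
      using mean_rescale[OF v that(1), of 2 x] by (simp add: b_def q_def)
    also have "\<dots> = (LINT y|lborel. v y * of_real (b 2 t y / t ^ ?d))"
      by (subst integral_scaleR_right[symmetric]) (simp add: scaleR_conv_of_real field_simps)
    also have "\<dots> = integral (cbox c d) (\<lambda>y. v y * of_real (b 2 t y / t ^ ?d))"
      by (rule lint_eq_integral_cbox)
         (use that b0' in \<open>auto simp: b_def intro!: continuous_intros cv cq\<close>)
    finally show ?thesis .
  qed
  \<comment> \<open>The bracket is the right-hand side of \<open>laplacian_bump\<close> for c =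
    1/t^2; \<open>deriv\<close> checks that the same expression is the t-derivative.\<close>
  define D where "D t y = (t / 2) * (4 * (1 / t\<^sup>2)\<^sup>2 * q y * (b 4 t y - 2 * b 3 t y) - 2 * (1 / t\<^sup>2) * ?d * b 2 t y) / t ^ ?d" for t y
  have deriv: "((\<lambda>t. b 2 t y / t ^ ?d) has_real_derivative D t y) (at t)" if t: "0 < t" for t y
  proof -
    have 1: "((\<lambda>t. 1 - (1 / t\<^sup>2) * q y) has_real_derivative 2 * q y / t ^ 3) (at t)"
      using t by (auto intro!: derivative_eq_intros simp: field_simps power2_eq_square power3_eq_cube)
    have 2: "((\<lambda>t. b 2 t y) has_real_derivative (b 4 t y - 2 * b 3 t y) * (2 * q y / t ^ 3)) (at t)"
      using DERIV_chain2[OF bump_deriv[of 2] 1] by (simp add: b_def)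
    obtain n where n: "?d = Suc n" using DIM_positive by (metis Suc_pred')
    show ?thesis
      by (rule derivative_eq_intros 2 refl)+
         (use t in \<open>simp_all add: D_def n field_simps power2_eq_square power3_eq_cube\<close>)
  qed
  have "((\<lambda>t. integral (cbox c d) (\<lambda>y. v y * of_real (b 2 t y / t ^ ?d))) has_vector_derivative
      integral (cbox c d) (\<lambda>y. v y * of_real (D s y))) (at s within {0<..<R})"
  proof (rule leibniz_rule_vector_derivative)
    show "((\<lambda>t. v y * of_real (b 2 t y / t ^ ?d)) has_vector_derivative v y * of_real (D t y)) (at t within {0<..<R})"
      if "t \<in> {0<..<R}" for t y
    proof -
      have "((\<lambda>t. b 2 t y / t ^ ?d) has_real_derivative D t y) (at t within {0<..<R})"
        using deriv[of t y] that by (simp add: has_field_derivative_at_within)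
      then show ?thesis by (intro has_vector_derivative_mult_right has_vector_derivative_of_real)
    qed
    show "(\<lambda>y. v y * of_real (b 2 t y / t ^ ?d)) integrable_on cbox c d" if "t \<in> {0<..<R}" for t
      using that by (intro integrable_continuous) (auto simp: b_def intro!: continuous_intros cv cq)
    show "continuous_on ({0<..<R} \<times> cbox c d) (\<lambda>(t, y). v y * of_real (D t y))"
      unfolding split_beta D_def b_def
      by (auto intro!: continuous_intros continuous_on_compose2[OF cv[of UNIV]] continuous_on_compose2[OF cq[of UNIV]])
  qed (use s in auto)
  then have "((\<lambda>t. integral (cbox c d) (\<lambda>y. v y * of_real (b 2 t y / t ^ ?d))) has_vector_derivative
      integral (cbox c d) (\<lambda>y. v y * of_real (D s y))) (at s)"
    using s by (simp add: at_within_open[of s "{0<..<R}"])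
  then have 1: "(mean 2 v x has_vector_derivative integral (cbox c d) (\<lambda>y. v y * of_real (D s y))) (at s)"
    by (rule has_vector_derivative_transform_within_open[where S="{0<..<R}"]) (use s mean_eq in auto)
  have cb: "y \<notin> cball x s" if "y \<notin> \<Omega>" for y using that R s by (auto simp: subset_iff)
  define \<phi> where "\<phi> y = complex_of_real (b 0 s y)" for y
  have \<phi>: "\<phi> \<in> test_functions \<Omega>"
  proof (rule test_functionsI[of _ "cball x s"])
    show "smooth \<phi>" unfolding \<phi>_def b_def q_def by (rule smooth_bump)
  qed (use s R b0 in \<open>auto simp: \<phi>_def\<close>)
  have lap: "laplacian \<phi> y = of_real (2 * s ^ ?d / s * D s y)" for y
    using laplacian_bump[of "1 / s\<^sup>2" x y] s by (simp add: \<phi>_def[abs_def] b_def q_def D_def)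
  have D0: "D s y = 0" if "y \<notin> cball x s" for y using b0[OF that s(1)] by (simp add: D_def)
  have "integral (cbox c d) (\<lambda>y. v y * of_real (D s y)) = (LINT y|lborel. v y * of_real (D s y))"
    by (rule lint_eq_integral_cbox[symmetric])
       (use s b0' in \<open>auto simp: D_def b_def intro!: continuous_intros cv cq\<close>)
  also have "\<dots> = (LINT y:\<Omega>|lborel. v y * of_real (D s y))"
    by (rule set_lint_supported[symmetric]) (simp add: D0[OF cb])
  also have "\<dots> = (LINT y:\<Omega>|lborel. (s / (2 * s ^ ?d)) *\<^sub>R (v y * laplacian \<phi> y))"
    using s by (simp add: lap scaleR_conv_of_real)
  also have "\<dots> = (s / (2 * s ^ ?d)) *\<^sub>R (LINT y:\<Omega>|lborel. w y * \<phi> y)"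
    using L \<phi> by (simp add: distr_laplacian_def)
  also have "(LINT y:\<Omega>|lborel. w y * \<phi> y) = (LINT y|lborel. w y * \<phi> y)"
    by (rule set_lint_supported) (simp add: \<phi>_def b0[OF cb s(1)])
  also have "\<dots> = s ^ ?d *\<^sub>R mean 0 w x s"
    using mean_rescale[OF w s(1), of 0 x] by (simp add: \<phi>_def b_def q_def)
  finally have "integral (cbox c d) (\<lambda>y. v y * of_real (D s y)) = (s / 2) *\<^sub>R mean 0 w x s"
    using s by simp
  with 1 show ?thesis by simp
qed

text \<open>Dominated convergence along sequences of radii; a uniform bound on the unit ball
  suffices because the kernel vanishes outside. The integrand is a family \<open>f s\<close> because
  difference quotients, and not only translates, will be inserted.\<close>

lemma tendsto_weighted_integral:
  fixes f :: "real \<Rightarrow> 'a::euclidean_space \<Rightarrow> complex"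
  assumes cf: "\<And>s. s \<in> {0<..<R} \<Longrightarrow> continuous_on UNIV (f s)" and cg: "continuous_on UNIV g"
    and B: "\<And>s z. s \<in> {0<..<R} \<Longrightarrow> z \<in> cball 0 1 \<Longrightarrow> norm (f s z) \<le> B"
    and lim: "\<And>z. ((\<lambda>s. f s z) \<longlongrightarrow> g z) (at_right 0)" and R: "0 < R"
  shows "((\<lambda>s. LINT z|lborel. f s z * of_real (kernel m z)) \<longlongrightarrow>
    (LINT z|lborel. g z * of_real (kernel m z))) (at_right 0)"
proof -
  have "((\<lambda>s. LINT z|lborel. f s z * of_real (kernel m z)) \<longlongrightarrow>
    (LINT z|lborel. g z * of_real (kernel m z))) (at 0 within {0<..<R})"
    unfolding tendsto_at_iff_sequentially comp_def
  proof (intro allI impI)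
    fix X assume X: "\<forall>i. X i \<in> {0<..<R} - {0::real}" "X \<longlonglongrightarrow> 0"
    then have X1: "X i \<in> {0<..<R}" for i by auto
    have flim: "filterlim X (at_right 0) sequentially"
      unfolding filterlim_at using X(2) X1 less_imp_neq[of 0 "X _"]
      by (auto intro!: always_eventually)
    show "(\<lambda>i. LINT z|lborel. f (X i) z * of_real (kernel m z)) \<longlonglongrightarrow>
        (LINT z|lborel. g z * of_real (kernel m z))"
    proof (rule integral_dominated_convergence[where w="\<lambda>z. kernel m z *\<^sub>R B"])
      show "(\<lambda>z. g z * of_real (kernel m z)) \<in> borel_measurable lborel"
        "(\<lambda>z. f (X i) z * of_real (kernel m z)) \<in> borel_measurable lborel" for i
        using cg cf[OF X1] by (auto intro!: borel_measurable_continuous_onI continuous_intros)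
      show "integrable lborel (\<lambda>z::'a. kernel m z *\<^sub>R B)" by (intro integrable_kernel continuous_intros)
      show "AE z in lborel. (\<lambda>i. f (X i) z * of_real (kernel m z)) \<longlonglongrightarrow> g z * of_real (kernel m z)"
        using filterlim_compose[OF lim flim] by (auto intro!: AE_I2 tendsto_mult tendsto_const)
      show "AE z in lborel. norm (f (X i) z * of_real (kernel m z)) \<le> kernel m z *\<^sub>R B" for i
      proof (rule AE_I2)
        fix z :: 'a
        show "norm (f (X i) z * of_real (kernel m z)) \<le> kernel m z *\<^sub>R B"
        proof (cases "z \<in> cball 0 1")
          case True
          then show ?thesis using mult_right_mono[OF B[OF X1 True, of i] bump_nonneg[of m "1 - z \<bullet> z"]]
            by (simp add: norm_mult bump_nonneg mult.commute)
        qed (simp add: kernel_zero)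
      qed
    qed
  qed
  moreover have "at 0 within {0<..<R} = at_right 0"
    by (rule at_within_nhd[of _ "{-R<..<R}"]) (use R in auto)
  ultimately show ?thesis by simp
qed

section \<open>Behaviour of the means for small radii and its consequences\<close>

lemma lint_const_kernel:
  "(LINT z|lborel. c * complex_of_real (kernel m (z::'a::euclidean_space))) = c * of_real (mass TYPE('a) m)"
  by simp

lemma mean_tendsto:
  fixes v :: "'a::euclidean_space \<Rightarrow> complex"
  assumes v: "continuous_on UNIV v" and B: "\<And>y. norm (v y) \<le> B"
  shows "(mean m v x \<longlongrightarrow> v x * of_real (mass TYPE('a) m)) (at_right 0)"
proof -
  have "((\<lambda>s. LINT z|lborel. v (x + s *\<^sub>R z) * of_real (kernel m z)) \<longlongrightarrow>
    (LINT z|lborel. v x * of_real (kernel m (z::'a)))) (at_right 0)"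
  proof (rule tendsto_weighted_integral[where R=1 and B=B])
    fix z
    have "isCont v x" using v by (simp add: continuous_on_eq_continuous_at)
    moreover have "((\<lambda>s. x + s *\<^sub>R z) \<longlongrightarrow> x + 0 *\<^sub>R z) (at_right 0)" by (intro tendsto_intros)
    ultimately show "((\<lambda>s. v (x + s *\<^sub>R z)) \<longlongrightarrow> v x) (at_right 0)"
      using isCont_tendsto_compose by fastforce
  qed (auto intro!: continuous_intros continuous_on_compose2[OF v] B)
  then show ?thesis unfolding lint_const_kernel by (simp add: mean_def[abs_def])
qed

text \<open>With \<open>w = 0\<close> on the ball the radius derivative of the mean is zero; the
  constant is identified by letting the radius tend to 0.\<close>

lemma mean_value_property:
  fixes v w :: "'a::euclidean_space \<Rightarrow> complex"
  assumes v: "continuous_on UNIV v" "\<And>y. norm (v y) \<le> B" and w: "continuous_on UNIV w"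
    and L: "distr_laplacian \<Omega> v w" and R: "ball x R \<subseteq> \<Omega>" and w0: "\<And>y. y \<in> ball x R \<Longrightarrow> w y = 0"
    and s: "0 < s" "s < R"
  shows "mean 2 v x s = v x * of_real (mass TYPE('a) 2)"
proof -
  have m0: "mean 0 w x t = 0" if "0 < t" "t < R" for t
  proof -
    have "w (x + t *\<^sub>R z) * of_real (kernel 0 z) = 0" for z
    proof (cases "z \<in> ball 0 1")
      case True
      then have "t * norm z < R" using that
        by (metis mem_ball_0 less_trans mult.right_neutral mult_strict_left_mono)
      then have "x + t *\<^sub>R z \<in> ball x R" using that by (simp add: dist_norm)
      then show ?thesis by (simp add: w0)
    qed (simp add: kernel_zero_sphere)
    then show ?thesis unfolding mean_def by (simp only: Bochner_Integration.integral_zero)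
  qed
  have "\<exists>c. \<forall>t\<in>{0<..<R}. mean 2 v x t = c"
  proof (rule has_derivative_zero_constant)
    show "(mean 2 v x has_derivative (\<lambda>h. 0)) (at t within {0<..<R})" if "t \<in> {0<..<R}" for t
      using mean_has_derivative[OF v(1) w L R, of t] that m0[of t]
      by (auto simp: has_vector_derivative_def intro: has_derivative_at_withinI)
  qed auto
  then obtain c where c: "\<And>t. t \<in> {0<..<R} \<Longrightarrow> mean 2 v x t = c" by blast
  have "(mean 2 v x \<longlongrightarrow> c) (at_right 0)"
  proof (rule Lim_transform_eventually[OF tendsto_const])
    show "\<forall>\<^sub>F t in at_right 0. c = mean 2 v x t"
      unfolding eventually_at_right_field using c s by (intro exI[of _ R]) auto
  qed
  moreover note mean_tendsto[OF v, of 2 x]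
  ultimately have "c = v x * of_real (mass TYPE('a) 2)"
    by (rule tendsto_unique[OF trivial_limit_at_right_real])
  then show ?thesis using c s by simp
qed

text \<open>Integrate the radius derivative (s/2) \<open>mean 0 w x s\<close>: its second factor
  tends to \<open>l\<close>, which gives s^2/4 times \<open>l\<close>, starting from the limit 0
  because \<open>v x = 0\<close>.\<close>

lemma mean_second_order:
  fixes v w :: "'a::euclidean_space \<Rightarrow> complex"
  assumes v: "continuous_on UNIV v" "\<And>y. norm (v y) \<le> B"
    and w: "continuous_on UNIV w" "\<And>y. norm (w y) \<le> C"
    and L: "distr_laplacian \<Omega> v w" and R: "0 < R" "ball x R \<subseteq> \<Omega>" and v0: "v x = 0"
  shows "((\<lambda>s. mean 2 v x s / of_real (s\<^sup>2)) \<longlongrightarrow> w x * of_real (mass TYPE('a) 0) / 4) (at_right 0)"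
proof (rule tendstoI)
  fix e :: real assume e: "0 < e"
  define l where "l = w x * of_real (mass TYPE('a) 0)"
  have "\<forall>\<^sub>F s in at_right 0. dist (mean 0 w x s) l < e"
    using mean_tendsto[OF w, of 0 x] e unfolding l_def by (rule tendstoD)
  then obtain d0 where d0: "d0 > 0" "\<And>s. 0 < s \<Longrightarrow> s < d0 \<Longrightarrow> dist (mean 0 w x s) l < e"
    unfolding eventually_at_right_field by auto
  define d where "d = min d0 R"
  have d: "d > 0" "\<And>s. 0 < s \<Longrightarrow> s < d \<Longrightarrow> norm (mean 0 w x s - l) \<le> e" "d \<le> R"
    using d0 R(1) by (force simp: d_def dist_norm)+
  define G where "G s = mean 2 v x s - (s\<^sup>2 / 4) *\<^sub>R l" for s
  have dG: "(G has_derivative (\<lambda>h. h *\<^sub>R ((s / 2) *\<^sub>R (mean 0 w x s - l)))) (at s)" if "0 < s" "s < d" for s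
  proof -
    have "(mean 2 v x has_vector_derivative (s / 2) *\<^sub>R mean 0 w x s) (at s)"
      by (rule mean_has_derivative[OF v(1) w(1) L R(2)]) (use that d in auto)
    moreover have "((\<lambda>s. s\<^sup>2 / 4) has_real_derivative s / 2) (at s)"
      by (auto intro!: derivative_eq_intros)
    then have "((\<lambda>s. (s\<^sup>2 / 4) *\<^sub>R l) has_vector_derivative (s / 2) *\<^sub>R l) (at s)"
      using has_vector_derivative_scaleR[OF _ has_vector_derivative_const, of _ _ s UNIV l] by fastforce
    ultimately have "(G has_vector_derivative (s / 2) *\<^sub>R mean 0 w x s - (s / 2) *\<^sub>R l) (at s)"
      unfolding G_def by (rule has_vector_derivative_diff)
    then show ?thesis by (simp add: has_vector_derivative_def scaleR_diff_right)
  qed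
  \<comment> \<open>The mean value inequality is used only between positive radii, where the means
    are differentiable; letting \<open>t\<close> tend to 0 comes afterwards. The factor u/2 in the
    derivative is at most s/2 and provides the second power of \<open>s\<close>.\<close>
  have Gdiff: "norm (G s - G t) \<le> e * s\<^sup>2 / 2" if "0 < t" "t < s" "s < d" for s t
  proof -
    have "norm (G s - G t) \<le> (s / 2 * e) * norm (s - t)"
    proof (rule differentiable_bound[of "{t..s}"])
      show "(G has_derivative (\<lambda>h. h *\<^sub>R ((u / 2) *\<^sub>R (mean 0 w x u - l)))) (at u within {t..s})"
        if "u \<in> {t..s}" for u
      proof (rule has_derivative_at_withinI, rule dG)
        show "0 < u" "u < d" using that \<open>0 < t\<close> \<open>s < d\<close> by auto
      qed
      show "onorm (\<lambda>h. h *\<^sub>R ((u / 2) *\<^sub>R (mean 0 w x u - l))) \<le> s / 2 * e" if "u \<in> {t..s}" for u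
      proof (rule onorm_le)
        fix h
        have *: "u / 2 * norm (mean 0 w x u - l) \<le> s / 2 * e"
          using that \<open>0 < t\<close> \<open>s < d\<close> d(2)[of u] by (intro mult_mono) auto
        then show "norm (h *\<^sub>R ((u / 2) *\<^sub>R (mean 0 w x u - l))) \<le> s / 2 * e * norm h"
          using that \<open>0 < t\<close> mult_left_mono[OF * abs_ge_zero[of h]]
          by (simp add: abs_mult mult.assoc mult.commute mult.left_commute)
      qed
    qed (use that in auto)
    also have "\<dots> \<le> (s / 2 * e) * s" using that e by (intro mult_left_mono) auto
    finally show ?thesis by (simp add: power2_eq_square mult.commute mult.left_commute)
  qed
  have G0: "(G \<longlongrightarrow> 0) (at_right 0)"
  proof -
    have "((\<lambda>s. mean 2 v x s - (s\<^sup>2 / 4) *\<^sub>R l) \<longlongrightarrow> v x * of_real (mass TYPE('a) 2) - (0\<^sup>2 / 4) *\<^sub>R l) (at_right 0)"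
      by (intro tendsto_intros mean_tendsto[OF v]) auto
    then show ?thesis by (simp add: G_def[abs_def] v0)
  qed
  have Gs: "norm (G s) \<le> e * s\<^sup>2 / 2" if "0 < s" "s < d" for s
  proof (rule tendsto_upperbound)
    show "((\<lambda>t. norm (G s - G t)) \<longlongrightarrow> norm (G s)) (at_right 0)"
      using tendsto_norm[OF tendsto_diff[OF tendsto_const G0], of "G s"] by simp
    show "\<forall>\<^sub>F t in at_right 0. norm (G s - G t) \<le> e * s\<^sup>2 / 2"
      unfolding eventually_at_right_field using that Gdiff by (intro exI[of _ s]) auto
  qed simp
  have "dist (mean 2 v x s / of_real (s\<^sup>2)) (l / 4) < e" if "0 < s" "s < d" for s
  proof -
    have "mean 2 v x s / of_real (s\<^sup>2) - l / 4 = G s / of_real (s\<^sup>2)"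
      using that by (simp add: G_def scaleR_conv_of_real field_simps)
    then have "dist (mean 2 v x s / of_real (s\<^sup>2)) (l / 4) = norm (G s) / s\<^sup>2"
      by (simp add: dist_norm norm_divide norm_power)
    also have "\<dots> \<le> e / 2" using Gs[OF that] that by (simp add: field_simps)
    finally show ?thesis using e by simp
  qed
  then show "\<forall>\<^sub>F s in at_right 0. dist (mean 2 v x s / of_real (s\<^sup>2)) (w x * of_real (mass TYPE('a) 0) / 4) < e"
    unfolding eventually_at_right_field l_def[symmetric] using d by (intro exI[of _ d]) auto
qed

text \<open>The argument of Weyl's lemma: by the mean value property at one fixed radius,
  \<open>v\<close> near \<open>x0\<close> is a constant multiple of its convolution with a smooth
  kernel, and the derivative can be put on the kernel.\<close>

lemma differentiable_of_laplacian_zero: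
  fixes v w :: "'a::euclidean_space \<Rightarrow> complex"
  assumes v: "continuous_on UNIV v" "\<And>y. norm (v y) \<le> B" and w: "continuous_on UNIV w"
    and L: "distr_laplacian \<Omega> v w" and R: "0 < R" "ball x0 R \<subseteq> \<Omega>"
    and w0: "\<And>y. y \<in> ball x0 R \<Longrightarrow> w y = 0"
  shows "v differentiable (at x0)"
proof -
  let ?d = "DIM('a)"
  \<comment> \<open>For \<open>x\<close> within R/2 of \<open>x0\<close> the ball of radius R/2
    about \<open>x\<close> stays in \<open>ball x0 R\<close>, so any radius below R/2 serves all
    such \<open>x\<close> simultaneously.\<close>
  define s where "s = R / 4"
  have s: "0 < s" "s < R / 2" using R by (auto simp: s_def)
  obtain a b where ab: "ball x0 R \<subseteq> cbox a b" using bounded_subset_cbox_symmetric[OF bounded_ball] by metis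
  define k where "k m x y = bump m (1 - (1 / s\<^sup>2) * ((x - y) \<bullet> (x - y)))" for m and x y :: 'a
  define F where "F x y = k 2 x y *\<^sub>R v y" for x y
  have cv: "continuous_on S v" for S using v(1) continuous_on_subset by blast
  have cF: "continuous_on S (F x)" for S x
    unfolding F_def k_def by (intro continuous_intros cv)
  have rep: "v x * of_real (mass TYPE('a) 2 * s ^ ?d) = integral (cbox a b) (F x)"
    if "x \<in> ball x0 (R / 2)" for x
  proof -
    have sub: "ball x (R / 2) \<subseteq> ball x0 R"
    proof
      fix y assume "y \<in> ball x (R / 2)"
      then show "y \<in> ball x0 R" using that dist_triangle[of x0 y x] by simp
    qed
    have "mean 2 v x s = v x * of_real (mass TYPE('a) 2)"
      by (rule mean_value_property[OF v w L _ _ s]) (use sub R w0 in auto)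
    then have "v x * of_real (mass TYPE('a) 2 * s ^ ?d) = s ^ ?d *\<^sub>R mean 2 v x s"
      by (simp add: scaleR_conv_of_real)
    also have "\<dots> = (LINT y|lborel. F x y)"
      unfolding mean_rescale[OF v(1) s(1)]
      by (intro Bochner_Integration.integral_cong refl)
         (simp add: F_def k_def scaleR_conv_of_real inner_diff inner_commute algebra_simps)
    also have "\<dots> = integral (cbox a b) (F x)"
    proof (rule lint_eq_integral_cbox[OF cF])
      fix y assume y: "y \<notin> cbox a b"
      have "cball x s \<subseteq> ball x (R / 2)" using s by auto
      then have "y \<notin> cball x s" using y sub ab by blast
      then have "k 2 x y = 0" using scaled_bump_zero[OF s(1), of y x 2]
        by (simp add: k_def inner_diff inner_commute algebra_simps)
      then show "F x y = 0" by (simp add: F_def)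
    qed
    finally show ?thesis .
  qed
  \<comment> \<open>The Leibniz rule for a vector parameter wants the derivative as a bounded linear
    function that depends continuously on both arguments; \<open>Dh\<close> recovers the plain
    formula.\<close>
  define D where "D x y = blinfun_scaleR_left (((k 4 x y - 2 * k 3 x y) * (- 2 * (1 / s\<^sup>2))) *\<^sub>R v y) o\<^sub>L
      blinfun_inner_right (x - y)" for x y
  have Dh: "blinfun_apply (D x y) =
      (\<lambda>h. ((k 4 x y - 2 * k 3 x y) * (- 2 * (1 / s\<^sup>2) * ((x - y) \<bullet> h))) *\<^sub>R v y)" for x y
    by (rule ext, simp add: D_def mult.assoc mult.commute mult.left_commute)
  have "((\<lambda>x. integral (cbox a b) (F x)) has_derivative integral (cbox a b) (D x0)) (at x0 within ball x0 (R / 2))"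
  proof (rule leibniz_rule)
    show "((\<lambda>x. F x y) has_derivative D x y) (at x within ball x0 (R / 2))" for x y
    proof (rule has_derivative_at_withinI)
      have "((\<lambda>x. k 2 x y) has_derivative
          (\<lambda>h. (k 4 x y - 2 * k 3 x y) * (- 2 * (1 / s\<^sup>2) * ((x - y) \<bullet> h)))) (at x)"
        using bump_radial_deriv[of 2 1 "1 / s\<^sup>2" y x] by (simp add: k_def)
      from has_derivative_scaleR_left[OF this, of "v y"]
      show "((\<lambda>x. F x y) has_derivative D x y) (at x)"
        unfolding F_def Dh .
    qed
    show "F x integrable_on cbox a b" for x by (intro integrable_continuous cF)
    show "continuous_on (ball x0 (R / 2) \<times> cbox a b) (\<lambda>(x, y). D x y)"
      unfolding split_beta D_def k_def
      by (intro continuous_intros continuous_on_compose2[OF cv[of UNIV]]) auto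
  qed (use R in auto)
  then have "((\<lambda>x. integral (cbox a b) (F x)) has_derivative integral (cbox a b) (D x0)) (at x0)"
    by (subst (asm) at_within_open) (use R in auto)
  then have "((\<lambda>x. v x * of_real (mass TYPE('a) 2 * s ^ ?d)) has_derivative integral (cbox a b) (D x0)) (at x0)"
  proof (rule has_derivative_transform_within_open[OF _ open_ball])
    show "x0 \<in> ball x0 (R / 2)" using R by simp
  qed (rule rep[symmetric])
  then obtain D' where D': "((\<lambda>x. v x * of_real (mass TYPE('a) 2 * s ^ ?d)) has_derivative D') (at x0)"
    by blast
  have "mass TYPE('a) 2 * s ^ ?d \<noteq> 0" using mass_pos[where 'a='a, of 2] s by simp
  moreover define c where "c = mass TYPE('a) 2 * s ^ ?d"
  ultimately have "c \<noteq> 0" by simp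
  then have "v = (\<lambda>x. v x * of_real c * inverse (of_real c))"
    by (simp add: mult.assoc flip: of_real_inverse of_real_mult)
  with has_derivative_mult_left[OF D'[folded c_def], of "inverse (of_real c)"]
  show ?thesis by (metis differentiableI)
qed

subsection \<open>Disjointness preserving functionals\<close>

lemma cutoff_test:
  fixes p :: "'a::euclidean_space"
  assumes "open \<Omega>" "p \<in> \<Omega>"
  obtains u r where "0 < r" "u \<in> test_functions \<Omega>" "\<And>x. x \<in> cball p r \<Longrightarrow> u x = 1"
proof -
  obtain R where R: "R > 0" "cball p R \<subseteq> \<Omega>" using assms open_contains_cball by blast
  have h: "0 < R / 2" "R / 2 < R" using R(1) by auto
  obtain u :: "'a \<Rightarrow> complex" where u: "smooth u" "\<And>x. x \<in> cball p (R / 2) \<Longrightarrow> u x = 1" "\<And>x. x \<notin> ball p R \<Longrightarrow> u x = 0"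
    using smooth_cutoff[OF h] by metis
  have "u x = 0" if "x \<notin> cball p R" for x
    by (rule u(3)) (use that in auto)
  then have "u \<in> test_functions \<Omega>" using u(1) R by (intro test_functionsI[of u "cball p R"]) auto
  with u(2) R(1) show ?thesis by (intro that[of "R / 2" u]) auto
qed

lemma C0_add:
  assumes "u \<in> C0 \<Omega>" "v \<in> C0 \<Omega>"
  shows "u + v \<in> C0 \<Omega>"
  unfolding C0_def closure_approachable
proof (intro allI impI)
  fix e :: real assume "e > 0"
  then have e: "e / 2 > 0" by simp
  obtain f where f: "f \<in> {u. apply_bcontfun u \<in> test_functions \<Omega>}" "dist f u < e / 2"
    using assms(1) e unfolding C0_def closure_approachable by blast
  obtain g where g: "g \<in> {u. apply_bcontfun u \<in> test_functions \<Omega>}" "dist g v < e / 2"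
    using assms(2) e unfolding C0_def closure_approachable by blast
  have "dist (f + g) (u + v) < e"
    using dist_triangle_add[of f g u v] f(2) g(2) by simp
  moreover have "apply_bcontfun (f + g) \<in> test_functions \<Omega>"
    using test_add[of f \<Omega> g] f(1) g(1) by (simp add: plus_bcontfun.rep_eq)
  ultimately show "\<exists>y\<in>{u. apply_bcontfun u \<in> test_functions \<Omega>}. dist y (u + v) < e" by blast
qed

locale disjointness_preserving_functional =
  fixes \<Omega> :: "'a::euclidean_space set" and L :: "('a \<Rightarrow>\<^sub>C complex) \<Rightarrow> complex" and B :: real
  assumes \<Omega>: "open \<Omega>"
    and add: "\<And>f g. f \<in> C0 \<Omega> \<Longrightarrow> g \<in> C0 \<Omega> \<Longrightarrow> L (f + g) = L f + L g"
    and scale: "\<And>f c. f \<in> C0 \<Omega> \<Longrightarrow> L (cscale c f) = c * L f"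
    and bound: "\<And>f. f \<in> C0 \<Omega> \<Longrightarrow> norm (L f) \<le> B * norm f"
    and disj: "\<And>f g. f \<in> C0 \<Omega> \<Longrightarrow> g \<in> C0 \<Omega> \<Longrightarrow> (\<And>x. f x * g x = 0) \<Longrightarrow> L f * L g = 0"
    and nonzero: "\<exists>f\<in>C0 \<Omega>. L f \<noteq> 0"
begin

text \<open>\<open>L\<close> read on plain functions, so that multiplication by smooth cutoffs needs
  no wrapping at each step.\<close>

definition l :: "('a \<Rightarrow> complex) \<Rightarrow> complex" where "l f = L (Bcontfun f)"

lemma B_nonneg: "0 \<le> B"
proof -
  obtain f where f: "f \<in> C0 \<Omega>" "L f \<noteq> 0" using nonzero by blast
  have "0 < B * norm f" using bound[OF f(1)] f(2) by (meson less_le_trans zero_less_norm_iff)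
  then show ?thesis by (simp add: zero_less_mult_iff)
qed

lemma l_add: "f \<in> test_functions \<Omega> \<Longrightarrow> g \<in> test_functions \<Omega> \<Longrightarrow> l (\<lambda>x. f x + g x) = l f + l g"
proof -
  assume fg: "f \<in> test_functions \<Omega>" "g \<in> test_functions \<Omega>"
  have "Bcontfun (\<lambda>x. f x + g x) = Bcontfun f + Bcontfun g"
    by (rule bcontfun_eqI) (simp add: test_bcontfun[OF fg(1)] test_bcontfun[OF fg(2)] test_bcontfun[OF test_add[OF fg]])
  then show ?thesis using add[OF test_C0[OF fg(1)] test_C0[OF fg(2)]] by (simp add: l_def)
qed

lemma l_scale: 
  assumes f: "f \<in> test_functions \<Omega>"
  shows "l (\<lambda>x. f x * c) = l f * c"
proof -
  have "Bcontfun (\<lambda>x. f x * c) = cscale c (Bcontfun f)"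
    by (rule bcontfun_eqI) (simp only: apply_cscale test_bcontfun[OF f] test_bcontfun[OF test_mult[OF f smooth_const]], rule mult.commute)
  then show ?thesis using scale[OF test_C0[OF f]] by (simp add: l_def mult.commute)
qed

lemma l_bound:
  assumes f: "f \<in> test_functions \<Omega>" and b: "\<And>x. norm (f x) \<le> b"
  shows "norm (l f) \<le> B * b"
proof -
  have "norm (Bcontfun f) \<le> b" by (rule norm_bound) (simp add: test_bcontfun[OF f] b)
  then have "B * norm (Bcontfun f) \<le> B * b" using B_nonneg by (rule mult_left_mono)
  with bound[OF test_C0[OF f]] show ?thesis by (simp add: l_def)
qed

lemma l_disj:
  assumes f: "f \<in> test_functions \<Omega>" and g: "g \<in> test_functions \<Omega>" and "\<And>x. f x * g x = 0"
  shows "l f = 0 \<or> l g = 0"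
  using disj[OF test_C0[OF f] test_C0[OF g]] assms(3) by (simp add: l_def test_bcontfun[OF f] test_bcontfun[OF g])

text \<open>Both sides are continuous for the supremum norm and test functions are dense: an
  approximation within \<open>e\<close> leaves an error of at most
  \<open>e * (B + norm c)\<close>.\<close>

lemma L_eq_if_test:
  assumes "\<And>f. f \<in> test_functions \<Omega> \<Longrightarrow> L (Bcontfun f) = c * f p"
    and u: "u \<in> C0 \<Omega>"
  shows "L u = c * u p"
proof -
  have "norm (L u - c * u p) \<le> e * (B + norm c)" if e: "e > 0" for e
  proof -
    obtain v where v: "apply_bcontfun v \<in> test_functions \<Omega>" "\<And>x. norm (u x - v x) < e"
      using C0_approx[OF u e] by blast
    have vC: "v \<in> C0 \<Omega>" using test_C0[OF v(1)] by (simp add: apply_bcontfun_inverse)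
    have Lv: "L v = c * v p" using assms(1)[OF v(1)] by (simp add: apply_bcontfun_inverse)
    have m: "cscale (-1) v \<in> C0 \<Omega>"
    proof -
      have "cscale (-1) v = Bcontfun (\<lambda>x. v x * (-1))"
        by (rule bcontfun_eqI) (simp only: apply_cscale test_bcontfun[OF test_mult[OF v(1) smooth_const]], rule mult.commute)
      then show ?thesis using test_C0[OF test_mult[OF v(1) smooth_const]] by (simp only:)
    qed
    define d where "d = u + cscale (-1) v"
    have dC: "L d = L u - L v" using add[OF u m] scale[OF vC, of "-1"] by (simp add: d_def)
    have d: "d \<in> C0 \<Omega>" unfolding d_def by (rule C0_add[OF u m])
    have "norm d \<le> e" by (rule norm_bound) (use v(2) in \<open>auto simp: d_def intro: less_imp_le\<close>)
    then have "norm (L u - L v) \<le> B * e"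
      using bound[OF d] B_nonneg mult_left_mono[of "norm d" e B] by (simp add: dC)
    moreover have "norm (L v - c * u p) \<le> norm c * e"
    proof -
      have "L v - c * u p = c * (v p - u p)" by (simp add: Lv right_diff_distrib)
      then show ?thesis using v(2)[of p]
        by (simp add: norm_mult norm_minus_commute mult_left_mono less_imp_le)
    qed
    ultimately show ?thesis
      using norm_triangle_ineq[of "L u - L v" "L v - c * u p"] by (simp add: algebra_simps)
  qed
  moreover have "B + norm c \<ge> 0" using B_nonneg by simp
  ultimately have "norm (L u - c * u p) \<le> 0"
  proof -
    assume *: "\<And>e. e > 0 \<Longrightarrow> norm (L u - c * u p) \<le> e * (B + norm c)" "B + norm c \<ge> 0"
    have "norm (L u - c * u p) \<le> 0 + d" if "d > 0" for d
    proof -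
      have "norm (L u - c * u p) \<le> d / (B + norm c + 1) * (B + norm c)"
        by (rule *(1)) (use *(2) that in simp)
      also have "\<dots> \<le> d" using *(2) that by (simp add: field_simps)
      finally show ?thesis by simp
    qed
    then show ?thesis by (rule field_le_epsilon)
  qed
  then show ?thesis by simp
qed

lemma l_zero: "l (\<lambda>x. 0) = 0"
proof -
  obtain f where "f \<in> C0 \<Omega>" using nonzero by blast
  then have "L (cscale 0 f) = 0" using scale by simp
  moreover have "cscale 0 f = Bcontfun (\<lambda>x. 0)"
    by (rule bcontfun_eqI) (simp add: Bcontfun_inverse const_bcontfun)
  ultimately show ?thesis by (simp add: l_def)
qed

lemma ex_test: "\<exists>f\<in>test_functions \<Omega>. l f \<noteq> 0"
  using L_eq_if_test[of 0] nonzero by (fastforce simp: l_def)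

text \<open>Otherwise every point of \<open>\<Omega>\<close> has a ball such that \<open>l\<close>
  kills all test functions vanishing outside it. Finitely many half balls cover the support of
  \<open>f\<close>, and \<open>f\<close> may be multiplied by 1 - \<open>u p\<close> for each of
  them without changing \<open>l f\<close>; the product is zero, so \<open>l\<close> would
  vanish.\<close>

lemma support_point:
  obtains p where "p \<in> \<Omega>" "\<And>r. 0 < r \<Longrightarrow> \<exists>f\<in>test_functions \<Omega>. l f \<noteq> 0 \<and> (\<forall>x. x \<notin> ball p r \<longrightarrow> f x = 0)"
proof (rule ccontr)
  note res = that
  assume neg: "\<not> thesis"
  have "\<exists>r>0. \<forall>f\<in>test_functions \<Omega>. (\<forall>x. x \<notin> ball p r \<longrightarrow> f x = 0) \<longrightarrow> l f = 0" if "p \<in> \<Omega>" for p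
    using res[of p] neg that by blast
  then obtain r where r: "\<And>p. p \<in> \<Omega> \<Longrightarrow> 0 < r p"
    "\<And>p f. p \<in> \<Omega> \<Longrightarrow> f \<in> test_functions \<Omega> \<Longrightarrow> (\<And>x. x \<notin> ball p (r p) \<Longrightarrow> f x = 0) \<Longrightarrow> l f = 0"
    by metis
  have "\<exists>u. smooth u \<and> (\<forall>x\<in>cball p (r p / 2). u x = 1) \<and> (\<forall>x. x \<notin> ball p (r p) \<longrightarrow> u x = (0::complex))"
    if "p \<in> \<Omega>" for p
    using smooth_cutoff[of "r p / 2" "r p" p] r(1)[OF that] by (metis field_sum_of_halves half_gt_zero less_add_same_cancel1)
  then obtain u :: "'a \<Rightarrow> 'a \<Rightarrow> complex" where u: "\<And>p. p \<in> \<Omega> \<Longrightarrow> smooth (u p)"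
    "\<And>p x. p \<in> \<Omega> \<Longrightarrow> x \<in> cball p (r p / 2) \<Longrightarrow> u p x = 1" "\<And>p x. p \<in> \<Omega> \<Longrightarrow> x \<notin> ball p (r p) \<Longrightarrow> u p x = 0"
    by metis
  have step: "l f = l (\<lambda>x. f x * (1 - u p x))" if f: "f \<in> test_functions \<Omega>" and p: "p \<in> \<Omega>" for f p
  proof -
    have s: "smooth (\<lambda>x. 1 - u p x)" by (intro smooth_diff smooth_const u p)
    have "l (\<lambda>x. f x * u p x) = 0"
      by (rule r(2)[OF p test_mult[OF f u(1)[OF p]]]) (simp add: u(3)[OF p])
    moreover have "f = (\<lambda>x. f x * u p x + f x * (1 - u p x))" by (simp add: algebra_simps)
    ultimately show ?thesis
      using l_add[OF test_mult[OF f u(1)[OF p]] test_mult[OF f s]] by simp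
  qed
  have tele: "l f = l (\<lambda>x. f x * (\<Prod>p\<in>F. 1 - u p x))" if "finite F" "F \<subseteq> \<Omega>" "f \<in> test_functions \<Omega>" for F f
    using that
  proof (induction F arbitrary: f rule: finite_induct)
    case empty
    then show ?case by simp
  next
    case (insert p F)
    have s: "smooth (\<lambda>x. 1 - u p x)" using insert.prems by (intro smooth_diff smooth_const u) auto
    have "l f = l (\<lambda>x. f x * (1 - u p x))" using insert.prems by (intro step) auto
    also have "\<dots> = l (\<lambda>x. f x * (1 - u p x) * (\<Prod>p\<in>F. 1 - u p x))"
      using insert.prems s by (intro insert.IH test_mult) auto
    finally show ?case using insert.hyps by (simp add: mult.assoc)
  qed
  have "l f = 0" if f: "f \<in> test_functions \<Omega>" for f
  proof -
    obtain K where K: "compact K" "K \<subseteq> \<Omega>" "\<And>x. x \<notin> K \<Longrightarrow> f x = 0" by (rule test_support[OF f]) auto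
    have "K \<subseteq> (\<Union>p\<in>\<Omega>. ball p (r p / 2))" using K(2) r(1) by fastforce
    then obtain F where F: "F \<subseteq> \<Omega>" "finite F" "K \<subseteq> (\<Union>p\<in>F. ball p (r p / 2))"
      using compactE_image[OF K(1), of \<Omega> "\<lambda>p. ball p (r p / 2)"] by auto
    have z: "f x * (\<Prod>p\<in>F. 1 - u p x) = 0" for x
    proof (cases "x \<in> K")
      case True
      then obtain p where "p \<in> F" "x \<in> ball p (r p / 2)" using F by blast
      then have "\<exists>p\<in>F. 1 - u p x = 0" using u(2)[of p x] F(1) by auto
      then show ?thesis using F(2) by (simp add: prod_zero)
    qed (simp add: K)
    show ?thesis using tele[OF F(2,1) f] l_zero unfolding z by simp
  qed
  then show False using ex_test by blast
qed

text \<open>By disjointness, \<open>l\<close> annihilates test functions vanishing near a support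
  point \<open>p\<close>; by boundedness, those vanishing merely at \<open>p\<close>. Its kernel
  thus contains that of the evaluation at \<open>p\<close>, which makes it a multiple of the
  evaluation.\<close>

lemma point_evaluation: "\<exists>p\<in>\<Omega>. \<exists>c. c \<noteq> 0 \<and> (\<forall>f\<in>C0 \<Omega>. L f = c * f p)"
proof -
  obtain p where p: "p \<in> \<Omega>" "\<And>r. 0 < r \<Longrightarrow> \<exists>f\<in>test_functions \<Omega>. l f \<noteq> 0 \<and> (\<forall>x. x \<notin> ball p r \<longrightarrow> f x = 0)"
    using support_point by blast
  have 1: "l f = 0" if f: "f \<in> test_functions \<Omega>" and r: "0 < r" "\<And>x. x \<in> ball p r \<Longrightarrow> f x = 0" for f r
  proof -
    obtain g where g: "g \<in> test_functions \<Omega>" "l g \<noteq> 0" "\<And>x. x \<notin> ball p r \<Longrightarrow> g x = 0"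
      using p(2)[OF r(1)] by blast
    have "f x * g x = 0" for x using g(3) r(2) by (cases "x \<in> ball p r") auto
    then show ?thesis using l_disj[OF f g(1)] g(2) by blast
  qed
  \<comment> \<open>A cutoff near \<open>p\<close> leaves \<open>l f\<close> unchanged by the
    preceding claim, and makes the function uniformly smaller than \<open>e'\<close> by continuity.
    The denominator \<open>B + 1\<close> in \<open>e'\<close> cannot be zero.\<close>
  have 2: "l f = 0" if f: "f \<in> test_functions \<Omega>" and f0: "f p = 0" for f
  proof -
    have "norm (l f) \<le> 0 + e" if e: "e > 0" for e
    proof -
      define e' where "e' = e / (B + 1)"
      have e': "e' > 0" using e B_nonneg by (simp add: e'_def)
      have "continuous_on UNIV f" using test_smooth[OF f] smooth_continuous by blast
      then obtain r where r: "r > 0" "\<And>x. dist x p < r \<Longrightarrow> norm (f x) < e'"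
        using e' f0 unfolding continuous_on_iff by (metis UNIV_I dist_0_norm dist_commute)
      have h: "0 < r / 2" "r / 2 < r" using r(1) by auto
      obtain u :: "'a \<Rightarrow> complex" where u: "smooth u" "\<And>x. x \<in> cball p (r / 2) \<Longrightarrow> u x = 1"
        "\<And>x. x \<notin> ball p r \<Longrightarrow> u x = 0" "\<And>x. norm (u x) \<le> 1"
        using smooth_cutoff[OF h] by metis
      have s: "smooth (\<lambda>x. 1 - u x)" by (intro smooth_diff smooth_const u)
      have z: "l (\<lambda>x. f x * (1 - u x)) = 0"
        by (rule 1[of _ "r / 2", OF test_mult[OF f s]]) (use r u(2) in auto)
      have "f = (\<lambda>x. f x * u x + f x * (1 - u x))" by (simp add: algebra_simps)
      then have "l f = l (\<lambda>x. f x * u x)"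
        using l_add[OF test_mult[OF f u(1)] test_mult[OF f s]] z by simp
      also have "norm \<dots> \<le> B * e'"
      proof (rule l_bound[OF test_mult[OF f u(1)]])
        show "norm (f x * u x) \<le> e'" for x
        proof (cases "x \<in> ball p r")
          case True
          then have "norm (f x) < e'" using r(2) by (simp add: dist_commute)
          then have "norm (f x) * norm (u x) \<le> e' * 1" using u(4) e' by (intro mult_mono) auto
          then show ?thesis by (simp add: norm_mult)
        qed (use u(3) e' in simp)
      qed
      also have "\<dots> \<le> e" using B_nonneg e by (simp add: e'_def field_simps)
      finally show ?thesis by simp
    qed
    then have "norm (l f) \<le> 0" by (rule field_le_epsilon)
    then show ?thesis by simp
  qed
  obtain u r where u: "0 < (r::real)" "u \<in> test_functions \<Omega>" "\<And>x. x \<in> cball p r \<Longrightarrow> u x = 1"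
    using cutoff_test[OF \<Omega> p(1)] by metis
  have up: "u p = 1" using u by simp
  have 3: "l f = l u * f p" if f: "f \<in> test_functions \<Omega>" for f
  proof -
    have m: "(\<lambda>x. u x * - f p) \<in> test_functions \<Omega>" by (intro test_mult u smooth_const)
    have "l (\<lambda>x. f x + u x * - f p) = 0" by (rule 2[OF test_add[OF f m]]) (simp add: up)
    then show ?thesis using l_add[OF f m] l_scale[OF u(2), of "- f p"] by simp
  qed
  then have "L f = l u * f p" if "f \<in> C0 \<Omega>" for f
    using L_eq_if_test[of "l u" p f] that by (simp add: l_def)
  moreover have "l u \<noteq> 0" using 3 ex_test by auto
  ultimately show ?thesis using p(1) by blast
qed

end

subsection \<open>Local isometries\<close>

lemma norm_preserving_inner:
  fixes B :: "'a::real_inner \<Rightarrow> 'b::real_inner"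
  assumes "linear B" "\<And>x. norm (B x) = norm x"
  shows "B x \<bullet> B y = x \<bullet> y"
  unfolding dot_norm using assms by (simp flip: linear_add)

lemma differentiable_bound_at:
  assumes "(f has_derivative A) (at x)"
  obtains C d where "0 < C" "0 < d" "\<And>h. norm h < d \<Longrightarrow> norm (f (x + h) - f x) \<le> C * norm h"
proof -
  interpret A: bounded_linear A using assms by (rule has_derivative_bounded_linear)
  obtain K where K: "0 < K" "\<And>x. norm (A x) \<le> norm x * K" using A.pos_bounded by blast
  obtain d where d: "d > 0" "\<And>y. norm (y - x) < d \<Longrightarrow> norm (f y - f x - A (y - x)) \<le> 1 * norm (y - x)"
    using assms zero_less_one unfolding has_derivative_at_alt by blast
  have "norm (f (x + h) - f x) \<le> (1 + K) * norm h" if "norm h < d" for h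
    using d(2)[of "x + h"] that K(2)[of h] norm_triangle_sub[of "f (x + h) - f x" "A h"]
    by (simp add: algebra_simps)
  with K d show ?thesis by (intro that[of "1 + K" d]) auto
qed

text \<open>Both \<open>f\<close> and its local inverse have derivatives of norm at most 1, so both
  are 1-Lipschitz on suitable balls, and the two inequalities combine.\<close>

lemma local_isometry:
  fixes f :: "'b::euclidean_space \<Rightarrow> 'a::euclidean_space"
  assumes dim: "DIM('a) \<le> DIM('b)" and S: "open S" "inj_on f S" "y0 \<in> S"
    and D: "\<And>y. y \<in> S \<Longrightarrow> (f has_derivative A y) (at y)"
    and nA: "\<And>y z. y \<in> S \<Longrightarrow> norm (A y z) = norm z"
    and B: "\<And>y. y \<in> S \<Longrightarrow> bounded_linear (B y)" "\<And>y z. y \<in> S \<Longrightarrow> B y (A y z) = z"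
      "\<And>y z. y \<in> S \<Longrightarrow> norm (B y z) = norm z"
  obtains r where "0 < r" "ball y0 r \<subseteq> S" "\<And>x y. x \<in> ball y0 r \<Longrightarrow> y \<in> ball y0 r \<Longrightarrow> dist (f x) (f y) = dist x y"
proof -
  have cf: "continuous_on S f"
    using D by (meson continuous_at_imp_continuous_on has_derivative_continuous)
  have op: "open (f ` T)" if "open T" "T \<subseteq> S" for T
    using that cf S(2) dim by (intro invariance_of_domain_gen) (auto intro: continuous_on_subset inj_on_subset)
  define g where "g = inv_into S f"
  have gf: "g (f y) = y" if "y \<in> S" for y using that S(2) by (simp add: g_def)
  have V: "open (f ` S)" by (rule op) (use S in auto)
  have cg: "continuous_on (f ` S) g"
  proof (rule continuous_on_inverse_open_map[OF cf refl gf])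
    fix T assume "openin (top_of_set S) T"
    then have "open T" "T \<subseteq> S" using S(1) openin_open_eq by auto
    then show "openin (top_of_set (f ` S)) (f ` T)" using op V by (auto simp: openin_open_eq)
  qed
  have Dg: "(g has_derivative B y) (at (f y))" if "y \<in> S" for y
  proof (rule has_derivative_inverse_basic[where f=f and f'="A y" and T="f ` S"])
    show "(f has_derivative A y) (at (g (f y)))" using D gf that by simp
    show "bounded_linear (B y)" "B y \<circ> A y = id" using B that by auto
    show "continuous (at (f y)) g" using cg V that by (auto simp: continuous_on_eq_continuous_at)
    show "f (g z) = z" if "z \<in> f ` S" for z using that gf by auto
  qed (use V that in auto)
  obtain r1 where r1: "r1 > 0" "ball y0 r1 \<subseteq> S" using S open_contains_ball by blast
  \<comment> \<open>The mean value inequality for \<open>g\<close> needs a convex domain, hence a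
    ball inside the open image.\<close>
  have "open (f ` ball y0 r1)" using r1 by (intro op) auto
  then obtain s where s: "s > 0" "ball (f y0) s \<subseteq> f ` ball y0 r1"
    using r1 open_contains_ball by (metis centre_in_ball image_eqI)
  have Lf: "norm (f x - f y) \<le> 1 * norm (x - y)" if "x \<in> ball y0 r1" "y \<in> ball y0 r1" for x y
  proof (rule differentiable_bound[OF convex_ball _ _ that])
    show "(f has_derivative A z) (at z within ball y0 r1)" if "z \<in> ball y0 r1" for z
      using D r1 that by (blast intro: has_derivative_at_withinI)
    show "onorm (A z) \<le> 1" if "z \<in> ball y0 r1" for z
      by (rule onorm_le) (use nA r1 that in auto)
  qed
  have Lg: "norm (g x - g y) \<le> 1 * norm (x - y)" if "x \<in> ball (f y0) s" "y \<in> ball (f y0) s" for x y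
  proof (rule differentiable_bound[OF convex_ball _ _ that])
    have in_S: "\<exists>w\<in>S. z = f w" if "z \<in> ball (f y0) s" for z using that s r1 by blast
    show "(g has_derivative B (g z)) (at z within ball (f y0) s)" if "z \<in> ball (f y0) s" for z
      using in_S[OF that] Dg gf by (auto intro: has_derivative_at_withinI)
    show "onorm (B (g z)) \<le> 1" if "z \<in> ball (f y0) s" for z
      by (rule onorm_le) (use in_S[OF that] B gf in auto)
  qed
  show ?thesis
  proof (rule that[of "min r1 s"])
    show "0 < min r1 s" "ball y0 (min r1 s) \<subseteq> S" using r1 s by auto
    fix x y assume xy: "x \<in> ball y0 (min r1 s)" "y \<in> ball y0 (min r1 s)"
    have b: "f z \<in> ball (f y0) s" if "z \<in> ball y0 (min r1 s)" for z
      using Lf[of y0 z] that r1(1) by (simp add: dist_norm)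
    have "z \<in> S" if "z \<in> ball y0 (min r1 s)" for z using that r1 by auto
    then have "dist x y \<le> dist (f x) (f y)" using Lg[OF b b, OF xy] xy gf by (simp add: dist_norm)
    moreover have "dist (f x) (f y) \<le> dist x y" using Lf[of x y] xy by (simp add: dist_norm)
    ultimately show "dist (f x) (f y) = dist x y" by simp
  qed
qed

text \<open>Polarisation turns preserved distances into preserved inner products based at
  \<open>y0\<close>. Differentiating this identity in the other variable gives (f y - f y0) . A v =
  (y - y0) . v, and \<open>v = B w\<close> moves \<open>A\<close> to the other side.\<close>

lemma isometry_on_ball_affine:
  fixes f :: "'b::real_inner \<Rightarrow> 'a::real_inner"
  assumes iso: "\<And>x y. x \<in> ball y0 r \<Longrightarrow> y \<in> ball y0 r \<Longrightarrow> dist (f x) (f y) = dist x y"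
    and D: "(f has_derivative A) (at y0)" and AB: "\<And>w. A (B w) = w" "\<And>z w. A z \<bullet> w = z \<bullet> B w"
    and y: "y \<in> ball y0 r"
  shows "f y = f y0 + A (y - y0)"
proof -
  have r: "y0 \<in> ball y0 r" using y by (simp add: le_less_trans[OF zero_le_dist])
  have ip: "(f y - f y0) \<bullet> (f x - f y0) = (y - y0) \<bullet> (x - y0)" if "x \<in> ball y0 r" for x
    using iso[OF y r] iso[OF that r] iso[OF y that] by (simp add: dot_norm_neg dist_norm)
  have "((\<lambda>x. (f y - f y0) \<bullet> (f x - f y0)) has_derivative (\<lambda>v. (f y - f y0) \<bullet> A v)) (at y0)"
    by (auto intro!: derivative_eq_intros D)
  then have "((\<lambda>x. (y - y0) \<bullet> (x - y0)) has_derivative (\<lambda>v. (f y - f y0) \<bullet> A v)) (at y0)"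
    by (rule has_derivative_transform_within_open[OF _ open_ball r ip])
  moreover have "((\<lambda>x. (y - y0) \<bullet> (x - y0)) has_derivative (\<lambda>v. (y - y0) \<bullet> v)) (at y0)"
    by (auto intro!: derivative_eq_intros)
  ultimately have eq: "(f y - f y0) \<bullet> A v = (y - y0) \<bullet> v" for v
    using has_derivative_unique by metis
  have "f y - f y0 = A (y - y0)"
  proof (rule vector_eq_rdot[THEN iffD1, rule_format])
    fix w
    show "(f y - f y0) \<bullet> w = A (y - y0) \<bullet> w" using eq[of "B w"] AB by simp
  qed
  then show ?thesis by (simp add: algebra_simps)
qed

subsection \<open>Weighted composition operators\<close>

lemma partial_inner: "partial i (\<lambda>x. complex_of_real ((x - p) \<bullet> e)) = (\<lambda>x. of_real (i \<bullet> e))"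
  by (rule ext, rule partial_eq) (auto intro!: derivative_eq_intros)

lemma laplacian_inner: "laplacian (\<lambda>x. complex_of_real ((x - p) \<bullet> e)) = (\<lambda>x. 0)"
  by (rule ext) (simp add: laplacian_def partial_inner partial_const)

lemma laplacian_inner_square:
  fixes p e :: "'c::euclidean_space"
  shows "laplacian (\<lambda>x. complex_of_real ((x - p) \<bullet> e) * of_real ((x - p) \<bullet> e)) = (\<lambda>x. of_real (2 * (e \<bullet> e)))"
proof -
  have 1: "partial i (\<lambda>x. complex_of_real ((x - p) \<bullet> e) * of_real ((x - p) \<bullet> e))
      = (\<lambda>x. of_real ((x - p) \<bullet> (2 * (i \<bullet> e)) *\<^sub>R e))" for i :: 'c
    by (rule ext, subst partial_mult) (simp_all add: smooth_inner partial_inner)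
  show ?thesis
    unfolding laplacian_def 1 partial_inner
    by (rule ext) (simp add: euclidean_inner[of e e] inner_commute sum_distrib_left mult.assoc)
qed

lemma laplacian_const: "laplacian (\<lambda>x. c) = (\<lambda>x. 0)"
  by (rule ext) (simp add: laplacian_def partial_const)

text \<open>The values of \<open>h\<close> and \<open>\<tau>\<close> off \<open>\<Omega>2\<close>
  are arbitrary and no regularity is given; it all has to come from \<open>image_U\<close> and
  \<open>lap\<close>.\<close>

locale weighted_composition =
  fixes \<Omega>1 :: "'a::euclidean_space set" and \<Omega>2 :: "'b::euclidean_space set"
    and U :: "('a \<Rightarrow>\<^sub>C complex) \<Rightarrow> ('b \<Rightarrow>\<^sub>C complex)" and h :: "'b \<Rightarrow> complex" and \<tau> :: "'b \<Rightarrow> 'a"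
  assumes open1: "open \<Omega>1" and open2: "open \<Omega>2"
    and tau_in: "\<And>y. y \<in> \<Omega>2 \<Longrightarrow> \<tau> y \<in> \<Omega>1" and h_nonzero: "\<And>y. y \<in> \<Omega>2 \<Longrightarrow> h y \<noteq> 0"
    and image_U: "U ` C0 \<Omega>1 = C0 \<Omega>2"
    and rep: "\<And>f y. f \<in> C0 \<Omega>1 \<Longrightarrow> y \<in> \<Omega>2 \<Longrightarrow> U f y = h y * f (\<tau> y)"
    and lap: "\<And>\<phi>. \<phi> \<in> test_functions \<Omega>1 \<Longrightarrow>
      distr_laplacian \<Omega>2 (U (Bcontfun \<phi>)) (U (Bcontfun (laplacian \<phi>)))"
begin

lemma rep_test: "\<phi> \<in> test_functions \<Omega>1 \<Longrightarrow> y \<in> \<Omega>2 \<Longrightarrow> U (Bcontfun \<phi>) y = h y * \<phi> (\<tau> y)"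
  using rep[OF test_C0] by (simp add: test_bcontfun)

text \<open>For a cutoff \<open>u\<close> supported in a neighbourhood \<open>W\<close> of
  \<open>\<tau> y0\<close>, the set where \<open>U (Bcontfun u)\<close> is nonzero is open, contains
  \<open>y0\<close>, and within \<open>\<Omega>2\<close> is mapped into \<open>W\<close>.\<close>

lemma continuous_tau: "continuous_on \<Omega>2 \<tau>"
  unfolding continuous_on_topological
proof (intro ballI allI impI)
  fix y0 W assume y0: "y0 \<in> \<Omega>2" and W: "open W" "\<tau> y0 \<in> W"
  obtain u r where u: "0 < (r::real)" "u \<in> test_functions (\<Omega>1 \<inter> W)" "\<And>x. x \<in> cball (\<tau> y0) r \<Longrightarrow> u x = 1"
    using cutoff_test[of "\<Omega>1 \<inter> W" "\<tau> y0"] open1 W tau_in[OF y0] by (metis IntI open_Int)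
  have u1: "u \<in> test_functions \<Omega>1" using u(2) by (auto simp: test_functions_def)
  have u0: "x \<in> W" if "u x \<noteq> 0" for x
    using test_support[OF u(2)] that by (metis IntD2 subsetD)
  have "open {y. U (Bcontfun u) y \<noteq> 0}" by (intro open_Collect_neq continuous_intros) auto
  moreover have "U (Bcontfun u) y0 \<noteq> 0" using rep_test[OF u1 y0] h_nonzero[OF y0] u(1,3) by simp
  moreover have "\<tau> y \<in> W" if "y \<in> \<Omega>2" "U (Bcontfun u) y \<noteq> 0" for y
    using rep_test[OF u1 that(1)] that(2) by (intro u0) auto
  ultimately show "\<exists>A. open A \<and> y0 \<in> A \<and> (\<forall>y\<in>\<Omega>2. y \<in> A \<longrightarrow> \<tau> y \<in> W)" by blast
qed

text \<open>Surjectivity of \<open>U\<close> provides a function with image 0 at \<open>x\<close>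
  and 1 at \<open>y\<close>, which is impossible if both points sample the same value of
  \<open>f\<close>.\<close>

lemma inj_tau: "inj_on \<tau> \<Omega>2"
proof (rule inj_onI, rule ccontr)
  fix x y assume xy: "x \<in> \<Omega>2" "y \<in> \<Omega>2" "\<tau> x = \<tau> y" "x \<noteq> y"
  have "open (\<Omega>2 - {x})" "y \<in> \<Omega>2 - {x}" using open2 xy by auto
  then obtain u r where u: "0 < (r::real)" "u \<in> test_functions (\<Omega>2 - {x})" "\<And>z. z \<in> cball y r \<Longrightarrow> u z = 1"
    using cutoff_test by metis
  have u2: "u \<in> test_functions \<Omega>2" using u(2) by (auto simp: test_functions_def)
  have ux: "u x = 0" using test_support[OF u(2)] by (metis Diff_iff insertI1 subsetD)
  obtain f where f: "f \<in> C0 \<Omega>1" "U f = Bcontfun u" using image_U test_C0[OF u2] by (metis imageE)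
  have "h x * f (\<tau> x) = 0" using rep[OF f(1) xy(1)] ux by (simp add: f(2) test_bcontfun[OF u2])
  moreover have "h y * f (\<tau> y) = 1" using rep[OF f(1) xy(2)] u(1,3) by (simp add: f(2) test_bcontfun[OF u2])
  ultimately show False using h_nonzero[OF xy(1)] xy(3) by simp
qed

text \<open>Cutting \<open>P\<close> off outside a neighbourhood of \<open>\<tau> y0\<close> yields
  a test function. The radius does not depend on \<open>P\<close>, so solutions for different
  \<open>P\<close> can be compared on one ball; \<open>v\<close> and \<open>w\<close> are bounded
  and continuous everywhere, as the results on means require.\<close>

lemma local_solution:
  assumes y0: "y0 \<in> \<Omega>2"
  obtains r where "0 < r" "ball y0 r \<subseteq> \<Omega>2" "\<And>P. smooth P \<Longrightarrow>
    \<exists>(v :: 'b \<Rightarrow>\<^sub>C complex) (w :: 'b \<Rightarrow>\<^sub>C complex). distr_laplacian \<Omega>2 v w \<and>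
      (\<forall>y\<in>ball y0 r. v y = h y * P (\<tau> y) \<and> w y = h y * laplacian P (\<tau> y))"
proof -
  obtain u s where u: "0 < (s::real)" "u \<in> test_functions \<Omega>1" "\<And>x. x \<in> cball (\<tau> y0) s \<Longrightarrow> u x = 1"
    using cutoff_test[OF open1 tau_in[OF y0]] by metis
  have "open (\<Omega>2 \<inter> \<tau> -` ball (\<tau> y0) s)"
    by (rule continuous_open_preimage[OF continuous_tau open2 open_ball])
  moreover have "y0 \<in> \<Omega>2 \<inter> \<tau> -` ball (\<tau> y0) s" using y0 u(1) by simp
  ultimately obtain r where r: "r > 0" "ball y0 r \<subseteq> \<Omega>2 \<inter> \<tau> -` ball (\<tau> y0) s"
    using open_contains_ball by blast
  show ?thesis
  proof (rule that[OF r(1)])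
    show "ball y0 r \<subseteq> \<Omega>2" using r by blast
    fix P :: "'a \<Rightarrow> complex" assume P: "smooth P"
    define \<phi> where "\<phi> x = u x * P x" for x
    have \<phi>: "\<phi> \<in> test_functions \<Omega>1" unfolding \<phi>_def by (rule test_mult[OF u(2) P])
    have eq: "\<phi> x = P x" if "x \<in> ball (\<tau> y0) s" for x using u(3)[of x] that by (simp add: \<phi>_def)
    have "U (Bcontfun \<phi>) y = h y * P (\<tau> y) \<and> U (Bcontfun (laplacian \<phi>)) y = h y * laplacian P (\<tau> y)"
      if "y \<in> ball y0 r" for y
    proof -
      have "y \<in> \<Omega>2" "\<tau> y \<in> ball (\<tau> y0) s" using that r(2) by auto
      then show ?thesis
        using rep_test[OF \<phi>] rep_test[OF test_laplacian[OF \<phi>]] eq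
          laplacian_cong_open[OF open_ball _ eq, of "\<tau> y"] by simp
    qed
    with lap[OF \<phi>] show "\<exists>(v :: 'b \<Rightarrow>\<^sub>C complex) (w :: 'b \<Rightarrow>\<^sub>C complex). distr_laplacian \<Omega>2 v w \<and>
      (\<forall>y\<in>ball y0 r. v y = h y * P (\<tau> y) \<and> w y = h y * laplacian P (\<tau> y))" by blast
  qed
qed

lemma differentiable_harmonic_composition:
  assumes "y0 \<in> \<Omega>2" "smooth P" "laplacian P = (\<lambda>x. 0)"
  shows "(\<lambda>y. h y * P (\<tau> y)) differentiable (at y0)"
proof -
  obtain r where r: "0 < r" "ball y0 r \<subseteq> \<Omega>2" "\<And>P. smooth P \<Longrightarrow>
    \<exists>(v :: 'b \<Rightarrow>\<^sub>C complex) (w :: 'b \<Rightarrow>\<^sub>C complex). distr_laplacian \<Omega>2 v w \<and>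
      (\<forall>y\<in>ball y0 r. v y = h y * P (\<tau> y) \<and> w y = h y * laplacian P (\<tau> y))"
    using local_solution[OF assms(1)] by blast
  obtain v w :: "'b \<Rightarrow>\<^sub>C complex" where vw: "distr_laplacian \<Omega>2 v w"
    "\<And>y. y \<in> ball y0 r \<Longrightarrow> v y = h y * P (\<tau> y)" "\<And>y. y \<in> ball y0 r \<Longrightarrow> w y = 0"
    using r(3)[OF assms(2)] by (auto simp: assms(3))
  have "apply_bcontfun v differentiable (at y0)"
    by (rule differentiable_of_laplacian_zero[OF _ norm_bounded _ vw(1) r(1,2) vw(3)]) auto
  then obtain D where D: "(apply_bcontfun v has_derivative D) (at y0)" by (auto simp: differentiable_def)
  have "((\<lambda>y. h y * P (\<tau> y)) has_derivative D) (at y0)"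
    by (rule has_derivative_transform_within_open[OF D open_ball _ vw(2)]) (use r in auto)
  then show ?thesis by (rule differentiableI)
qed

lemma differentiable_h: "y0 \<in> \<Omega>2 \<Longrightarrow> h differentiable (at y0)"
  using differentiable_harmonic_composition[OF _ smooth_const laplacian_const, of y0 1] by (simp only: mult_1_right)

text \<open>Each coordinate is the quotient of the differentiable functions obtained for a linear
  \<open>P\<close> and for \<open>P = 1\<close>. The quotient is complex-valued, so its real part is
  taken.\<close>

lemma differentiable_tau:
  assumes y0: "y0 \<in> \<Omega>2"
  shows "\<tau> differentiable (at y0)"
proof (subst differentiable_componentwise_within, rule ballI)
  fix i :: 'a
  have "(\<lambda>y. h y * of_real ((\<tau> y - 0) \<bullet> i) / h y) differentiable (at y0)"
    using differentiable_harmonic_composition[OF y0 smooth_inner[of 0 i] laplacian_inner[of 0 i]] differentiable_h[OF y0] h_nonzero[OF y0]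
    by (intro differentiable_divide) auto
  then obtain D where "((\<lambda>y. h y * of_real ((\<tau> y - 0) \<bullet> i) / h y) has_derivative D) (at y0)"
    by (auto simp: differentiable_def)
  then have "((\<lambda>y. Re (h y * of_real ((\<tau> y - 0) \<bullet> i) / h y)) has_derivative (\<lambda>z. Re (D z))) (at y0)"
    by (rule has_derivative_Re)
  then have "((\<lambda>y. \<tau> y \<bullet> i) has_derivative (\<lambda>z. Re (D z))) (at y0)"
    by (rule has_derivative_transform_within_open[OF _ open2 y0]) (simp add: h_nonzero)
  then show "(\<lambda>y. \<tau> y \<bullet> i) differentiable (at y0)" by (rule differentiableI)
qed

end

lemma continuous_on_bcontfun_compose:
  "continuous_on S g \<Longrightarrow> continuous_on S (\<lambda>x. apply_bcontfun v (g x))"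
  by (rule continuous_on_compose2[OF _ _ subset_UNIV]) auto

section \<open>Orthogonality of the derivative, local affinity and constancy of the weight\<close>

context weighted_composition
begin

text \<open>Comparing the second order expansion of the means of \<open>h ((\<tau> - \<tau> y0) \<bullet> e)\<^sup>2\<close> with its Laplacian
  \<open>2 \<parallel>e\<parallel>\<^sup>2 h\<close>.\<close>

lemma norm_adjoint_derivative:
  assumes y0: "y0 \<in> \<Omega>2" and A: "(\<tau> has_derivative A) (at y0)"
  shows "norm (adjoint A e) = norm e"
proof -
  define p where "p = \<tau> y0"
  define b where "b = adjoint A e"
  have lA: "linear A" using A by (rule has_derivative_linear)
  have Ab: "A z \<bullet> e = z \<bullet> b" for z using adjoint_works[OF lA, of z e] by (simp add: b_def)
  define q where "q y = (\<tau> y - p) \<bullet> e" for y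
  obtain r where r: "0 < r" "ball y0 r \<subseteq> \<Omega>2" "\<And>P. smooth P \<Longrightarrow>
    \<exists>(v :: 'b \<Rightarrow>\<^sub>C complex) (w :: 'b \<Rightarrow>\<^sub>C complex). distr_laplacian \<Omega>2 v w \<and>
      (\<forall>y\<in>ball y0 r. v y = h y * P (\<tau> y) \<and> w y = h y * laplacian P (\<tau> y))"
    using local_solution[OF y0] by blast
  \<comment> \<open>A globally bounded and continuous function equal to \<open>h\<close> near
    \<open>y0\<close>: it supplies the bound and the limit for the factor \<open>h\<close>.\<close>
  obtain v1 :: "'b \<Rightarrow>\<^sub>C complex" where v1: "\<And>y. y \<in> ball y0 r \<Longrightarrow> v1 y = h y"
    using r(3)[OF smooth_const[of 1]] unfolding mult_1_right by blast
  obtain v w :: "'b \<Rightarrow>\<^sub>C complex" where vw: "distr_laplacian \<Omega>2 v w"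
    "\<And>y. y \<in> ball y0 r \<Longrightarrow> v y = h y * (of_real (q y) * of_real (q y))"
    "\<And>y. y \<in> ball y0 r \<Longrightarrow> w y = h y * of_real (2 * (e \<bullet> e))"
    using r(3)[OF smooth_mult[OF smooth_inner[of p e] smooth_inner[of p e]]]
    unfolding laplacian_inner_square q_def by blast
  have yr: "y0 \<in> ball y0 r" using r(1) by simp
  have v0: "v y0 = 0" and w0: "w y0 = h y0 * of_real (2 * (e \<bullet> e))"
    using vw(2,3)[OF yr] by (simp_all add: q_def p_def)
  have lim1: "((\<lambda>s. mean 2 v y0 s / of_real (s\<^sup>2)) \<longlongrightarrow> w y0 * of_real (mass TYPE('b) 0) / 4) (at_right 0)"
    by (rule mean_second_order[OF _ norm_bounded _ norm_bounded vw(1) r(1,2) v0]) auto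
  \<comment> \<open>Differentiability at the single point \<open>y0\<close> bounds |q| by C s |e| at
    distance at most \<open>s\<close>, so q^2 / s^2 is dominated on the whole unit ball.\<close>
  obtain C d where Cd: "0 < C" "0 < d" "\<And>k. norm k < d \<Longrightarrow> norm (\<tau> (y0 + k) - \<tau> y0) \<le> C * norm k"
    using differentiable_bound_at[OF A] by blast
  define R where "R = min r d"
  have R: "0 < R" "R \<le> r" "R \<le> d" using r(1) Cd(2) by (auto simp: R_def)
  have small: "norm (s *\<^sub>R z) < R" if "s \<in> {0<..<R}" "z \<in> cball 0 1" for s and z :: 'b
  proof -
    have "norm (s *\<^sub>R z) = s * norm z" using that by simp
    also have "\<dots> \<le> s" using that by (simp add: mult_left_le)
    also have "\<dots> < R" using that by simp
    finally show ?thesis .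
  qed
  have lim2: "((\<lambda>s. LINT z|lborel. v (y0 + s *\<^sub>R z) / of_real (s\<^sup>2) * of_real (kernel 2 z)) \<longlongrightarrow>
    (LINT z|lborel. h y0 * of_real ((z \<bullet> b) * (z \<bullet> b)) * of_real (kernel 2 z))) (at_right 0)"
  proof (rule tendsto_weighted_integral[OF _ _ _ _ R(1), where B="norm v1 * (C * norm e)\<^sup>2"])
    show "continuous_on UNIV (\<lambda>z. v (y0 + s *\<^sub>R z) / of_real (s\<^sup>2))" if "s \<in> {0<..<R}" for s
      using that by (intro continuous_intros continuous_on_bcontfun_compose) auto
    show "continuous_on UNIV (\<lambda>z. h y0 * of_real ((z \<bullet> b) * (z \<bullet> b)))" by (intro continuous_intros)
  next
    fix s and z :: 'b assume s: "s \<in> {0<..<R}" and z: "z \<in> cball 0 1"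
    have n: "norm (s *\<^sub>R z) < R" by (rule small[OF s z])
    then have yb: "y0 + s *\<^sub>R z \<in> ball y0 r" using R by (simp add: dist_norm)
    have "\<bar>q (y0 + s *\<^sub>R z)\<bar> \<le> norm (\<tau> (y0 + s *\<^sub>R z) - \<tau> y0) * norm e"
      unfolding q_def p_def by (rule Cauchy_Schwarz_ineq2)
    also have "\<dots> \<le> (C * norm (s *\<^sub>R z)) * norm e"
      using Cd(3)[of "s *\<^sub>R z"] n R by (intro mult_right_mono) auto
    also have "\<dots> \<le> (C * s) * norm e"
      using s z Cd(1) by (intro mult_right_mono mult_left_mono) (auto simp: mult_left_le)
    finally have "\<bar>q (y0 + s *\<^sub>R z)\<bar>\<^sup>2 \<le> (C * s * norm e)\<^sup>2" by (rule power_mono) simp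
    then have "(q (y0 + s *\<^sub>R z))\<^sup>2 / s\<^sup>2 \<le> (C * norm e)\<^sup>2"
      using s by (simp add: field_simps power_mult_distrib)
    then have "norm (v1 (y0 + s *\<^sub>R z)) * ((q (y0 + s *\<^sub>R z))\<^sup>2 / s\<^sup>2) \<le> norm v1 * (C * norm e)\<^sup>2"
      by (intro mult_mono norm_bounded) auto
    then show "norm (v (y0 + s *\<^sub>R z) / of_real (s\<^sup>2)) \<le> norm v1 * (C * norm e)\<^sup>2"
      using vw(2)[OF yb] v1[OF yb] by (simp add: norm_mult norm_divide norm_power power2_eq_square)
  next
    fix z :: 'b
    have "((\<lambda>s. y0 + s *\<^sub>R z) has_derivative (\<lambda>s. s *\<^sub>R z)) (at 0)"
      by (auto intro!: derivative_eq_intros)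
    moreover have "(\<tau> has_derivative A) (at (y0 + 0 *\<^sub>R z))" using A by simp
    ultimately have "((\<lambda>s. \<tau> (y0 + s *\<^sub>R z)) has_derivative (\<lambda>s. A (s *\<^sub>R z))) (at 0)"
      by (rule has_derivative_compose)
    then have "((\<lambda>s. q (y0 + s *\<^sub>R z)) has_derivative (\<lambda>s. A (s *\<^sub>R z) \<bullet> e)) (at 0)"
      unfolding q_def by (auto intro!: derivative_eq_intros)
    then have "((\<lambda>s. q (y0 + s *\<^sub>R z)) has_real_derivative (z \<bullet> b)) (at 0)"
      unfolding has_field_derivative_def by (simp add: Ab mult_commute_abs)
    then have "((\<lambda>s. q (y0 + s *\<^sub>R z) / s) \<longlongrightarrow> z \<bullet> b) (at 0)"
      by (simp add: has_field_derivative_iff q_def p_def)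
    then have 1: "((\<lambda>s. q (y0 + s *\<^sub>R z) / s) \<longlongrightarrow> z \<bullet> b) (at_right 0)"
      by (rule tendsto_mono[OF at_le, rotated]) simp
    have "isCont v1 y0" using continuous_on_eq_continuous_at[of UNIV "apply_bcontfun v1"] by auto
    moreover have "((\<lambda>s. y0 + s *\<^sub>R z) \<longlongrightarrow> y0 + 0 *\<^sub>R z) (at_right 0)" by (intro tendsto_intros)
    ultimately have 2: "((\<lambda>s. v1 (y0 + s *\<^sub>R z)) \<longlongrightarrow> v1 y0) (at_right 0)"
      using isCont_tendsto_compose by fastforce
    have "((\<lambda>s. v1 (y0 + s *\<^sub>R z) * of_real ((q (y0 + s *\<^sub>R z) / s) * (q (y0 + s *\<^sub>R z) / s)))
        \<longlongrightarrow> v1 y0 * of_real ((z \<bullet> b) * (z \<bullet> b))) (at_right 0)"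
      by (intro tendsto_mult tendsto_of_real 1 2)
    moreover have "\<forall>\<^sub>F s in at_right 0. v1 (y0 + s *\<^sub>R z) * of_real ((q (y0 + s *\<^sub>R z) / s) * (q (y0 + s *\<^sub>R z) / s))
        = v (y0 + s *\<^sub>R z) / of_real (s\<^sup>2)"
      unfolding eventually_at_right_field
    proof (intro exI conjI allI impI)
      show "0 < r / (norm z + 1)" using r(1) by (simp add: add_nonneg_pos)
      fix s :: real assume s: "0 < s" "s < r / (norm z + 1)"
      have "s * (norm z + 1) < r" using s by (simp add: pos_less_divide_eq add_nonneg_pos)
      then have "norm (s *\<^sub>R z) < r" using s(1) by (simp add: distrib_left)
      then have yb: "y0 + s *\<^sub>R z \<in> ball y0 r" by (simp add: dist_norm)
      show "v1 (y0 + s *\<^sub>R z) * of_real ((q (y0 + s *\<^sub>R z) / s) * (q (y0 + s *\<^sub>R z) / s))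
        = v (y0 + s *\<^sub>R z) / of_real (s\<^sup>2)"
        using vw(2)[OF yb] v1[OF yb] by (simp add: power2_eq_square)
    qed
    ultimately show "((\<lambda>s. v (y0 + s *\<^sub>R z) / of_real (s\<^sup>2)) \<longlongrightarrow> h y0 * of_real ((z \<bullet> b) * (z \<bullet> b))) (at_right 0)"
      unfolding v1[OF yr] by (rule Lim_transform_eventually)
  qed
  have e1: "(LINT z|lborel. v (y0 + s *\<^sub>R z) / of_real (s\<^sup>2) * of_real (kernel 2 z)) = mean 2 v y0 s / of_real (s\<^sup>2)" for s
    unfolding mean_def times_divide_eq_left by (rule integral_divide_zero)
  have e2: "(LINT z|lborel. h y0 * of_real ((z \<bullet> b) * (z \<bullet> b)) * of_real (kernel 2 z)) = h y0 * of_real (b \<bullet> b / 2 * mass TYPE('b) 0)"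
    unfolding mult.assoc of_real_mult[symmetric] second_moment[symmetric]
    by (simp only: integral_mult_right_zero integral_complex_of_real mult.assoc)
  \<comment> \<open>The same limit computed twice: the second moment gives |b|^2 / 2, the Laplacian
    gives 2 |e|^2 / 4.\<close>
  have "h y0 * of_real (b \<bullet> b / 2 * mass TYPE('b) 0) = w y0 * of_real (mass TYPE('b) 0) / 4"
    by (rule tendsto_unique[OF trivial_limit_at_right_real lim2[unfolded e1 e2] lim1])
  also have "\<dots> = h y0 * of_real (e \<bullet> e / 2 * mass TYPE('b) 0)" by (simp add: w0)
  finally have "b \<bullet> b / 2 * mass TYPE('b) 0 = e \<bullet> e / 2 * mass TYPE('b) 0"
    using mult_left_cancel[OF h_nonzero[OF y0]] of_real_eq_iff by blast
  then have "b \<bullet> b = e \<bullet> e" using mass_pos[where 'a='b, of 0] by simp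
  then show ?thesis by (simp add: norm_eq_sqrt_inner b_def)
qed

text \<open>One inequality is linear: the adjoint preserves norms, hence is injective. The other is
  topological: \<open>\<tau>\<close> is a continuous injection on a non-empty open set.\<close>

lemma dim_eq:
  assumes y0: "y0 \<in> \<Omega>2"
  shows "DIM('a) = DIM('b)"
proof (rule antisym)
  obtain A where A: "(\<tau> has_derivative A) (at y0)" using differentiable_tau[OF y0] by (auto simp: differentiable_def)
  have lB: "linear (adjoint A)" using has_derivative_linear[OF A] by (rule adjoint_linear)
  have "inj (adjoint A)"
    unfolding linear_injective_0[OF lB] using norm_adjoint_derivative[OF y0 A] by (metis norm_eq_zero)
  then have "dim (range (adjoint A)) = DIM('a)"
    using dim_image_eq[OF lB, of UNIV] by simp
  then show "DIM('a) \<le> DIM('b)" using dim_subset_UNIV by metis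
  show "DIM('b) \<le> DIM('a)" using invariance_of_dimension[OF continuous_tau open2 inj_tau] y0 by blast
qed

text \<open>Polarisation of the norm identity makes the adjoint a right inverse of \<open>A\<close>;
  equal dimensions make the adjoint surjective, hence a two-sided inverse.\<close>

lemma derivative_orthogonal:
  assumes y0: "y0 \<in> \<Omega>2" and A: "(\<tau> has_derivative A) (at y0)"
  shows "A (adjoint A e) = e" "adjoint A (A z) = z" "norm (A z) = norm z"
proof -
  let ?B = "adjoint A"
  have lA: "linear A" by (rule has_derivative_linear[OF A])
  then have lB: "linear ?B" by (rule adjoint_linear)
  have nB: "norm (?B x) = norm x" for x by (rule norm_adjoint_derivative[OF y0 A])
  show AB: "A (?B e) = e" for e
  proof (rule vector_eq_rdot[THEN iffD1, rule_format])
    fix w show "A (?B e) \<bullet> w = e \<bullet> w"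
      using adjoint_works[OF lA, of "?B e" w] norm_preserving_inner[OF lB nB, of e w] by simp
  qed
  have "inj ?B" using AB by (metis injI)
  then have "dim (range ?B) = DIM('b)"
    using dim_image_eq[OF lB, of UNIV] dim_eq[OF y0] by simp
  then have "range ?B = UNIV"
    unfolding dim_eq_full using lB by (metis linear_span_image span_UNIV)
  then obtain x where "z = ?B x" by blast
  then show "?B (A z) = z" "norm (A z) = norm z" using AB nB by simp_all
qed

lemma tau_locally_affine:
  assumes y0: "y0 \<in> \<Omega>2"
  obtains r A where "0 < r" "ball y0 r \<subseteq> \<Omega>2" "(\<tau> has_derivative A) (at y0)"
    "\<And>y. y \<in> ball y0 r \<Longrightarrow> \<tau> y = \<tau> y0 + A (y - y0)"
proof -
  define A where "A y = frechet_derivative \<tau> (at y)" for y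
  have A: "(\<tau> has_derivative A y) (at y)" if "y \<in> \<Omega>2" for y
    using differentiable_tau[OF that] by (simp add: A_def frechet_derivative_works)
  note o = derivative_orthogonal[OF _ A]
  have bl: "bounded_linear (adjoint (A y))" if "y \<in> \<Omega>2" for y
    using A[OF that] by (simp add: adjoint_linear has_derivative_linear linear_conv_bounded_linear[symmetric])
  have dim: "DIM('a) \<le> DIM('b)" using dim_eq[OF y0] by simp
  obtain r where r: "0 < r" "ball y0 r \<subseteq> \<Omega>2"
    "\<And>x y. x \<in> ball y0 r \<Longrightarrow> y \<in> ball y0 r \<Longrightarrow> dist (\<tau> x) (\<tau> y) = dist x y"
    by (rule local_isometry[OF dim open2 inj_tau y0, of A "\<lambda>y. adjoint (A y)"])
       (use A o bl norm_adjoint_derivative in auto)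
  have "\<tau> y = \<tau> y0 + A y0 (y - y0)" if "y \<in> ball y0 r" for y
  proof (rule isometry_on_ball_affine[OF r(3) A[OF y0] _ _ that])
    show "A y0 (adjoint (A y0) w) = w" for w by (rule o[OF y0 y0])
    show "A y0 z \<bullet> w = z \<bullet> adjoint (A y0) w" for z w
      using adjoint_works[OF has_derivative_linear[OF A[OF y0]], of z w] by simp
  qed
  then show ?thesis by (rule that[OF r(1,2) A[OF y0]])
qed

text \<open>Since \<open>\<tau>\<close> is affine near \<open>y0\<close>, the function \<open>h ((\<tau> - \<tau> y0) \<bullet> e)\<close> is \<open>h (y - y0) \<bullet> b\<close>, and its mean
  value property at \<open>y0\<close> says that the derivative of \<open>h\<close> in direction \<open>b\<close> vanishes.\<close>

lemma derivative_h_zero: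
  assumes y0: "y0 \<in> \<Omega>2"
  shows "(h has_derivative (\<lambda>z. 0)) (at y0)"
proof -
  obtain D where D: "(h has_derivative D) (at y0)" using differentiable_h[OF y0] by (auto simp: differentiable_def)
  obtain r1 A where r1: "0 < r1" "ball y0 r1 \<subseteq> \<Omega>2" and A: "(\<tau> has_derivative A) (at y0)"
    and aff: "\<And>y. y \<in> ball y0 r1 \<Longrightarrow> \<tau> y = \<tau> y0 + A (y - y0)"
    using tau_locally_affine[OF y0] by blast
  have lA: "linear A" by (rule has_derivative_linear[OF A])
  obtain r2 where r2: "0 < r2" "ball y0 r2 \<subseteq> \<Omega>2" "\<And>P. smooth P \<Longrightarrow>
    \<exists>(v :: 'b \<Rightarrow>\<^sub>C complex) (w :: 'b \<Rightarrow>\<^sub>C complex). distr_laplacian \<Omega>2 v w \<and>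
      (\<forall>y\<in>ball y0 r2. v y = h y * P (\<tau> y) \<and> w y = h y * laplacian P (\<tau> y))"
    using local_solution[OF y0] by blast
  define r where "r = min r1 r2"
  have r: "0 < r" "ball y0 r \<subseteq> \<Omega>2" using r1 r2 by (auto simp: r_def)
  obtain v1 :: "'b \<Rightarrow>\<^sub>C complex" where v1: "\<And>y. y \<in> ball y0 r2 \<Longrightarrow> v1 y = h y"
    using r2(3)[OF smooth_const[of 1]] unfolding mult_1_right by blast
  have D1: "(apply_bcontfun v1 has_derivative D) (at y0)"
    by (rule has_derivative_transform_within_open[OF D open_ball _ v1[symmetric]]) (use r2 in auto)
  obtain C d where Cd: "0 < C" "0 < d" "\<And>k. norm k < d \<Longrightarrow> norm (v1 (y0 + k) - v1 y0) \<le> C * norm k"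
    using differentiable_bound_at[OF D1] by blast
  define R where "R = min r d"
  have R: "0 < R" "R \<le> r" "R \<le> d" using r(1) Cd(2) by (auto simp: R_def)
  have small: "norm (s *\<^sub>R z) < R" if "s \<in> {0<..<R}" "z \<in> cball 0 1" for s and z :: 'b
  proof -
    have "norm (s *\<^sub>R z) = s * norm z" using that by simp
    also have "\<dots> \<le> s" using that by (simp add: mult_left_le)
    also have "\<dots> < R" using that by simp
    finally show ?thesis .
  qed
  have cD: "continuous_on UNIV D" using D by (intro linear_continuous_on has_derivative_bounded_linear)
  have key: "(LINT z|lborel. D z * of_real (z \<bullet> b) * of_real (kernel 2 z)) = 0" for b
  proof -
    \<comment> \<open>The witness is \<open>A b\<close>, by orthogonality; every direction
      \<open>b\<close> is thus seen by some linear polynomial.\<close>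
    obtain e where e: "adjoint A e = b" using derivative_orthogonal(2)[OF y0 A] by blast
    have Ab: "A z \<bullet> e = z \<bullet> b" for z using adjoint_works[OF lA, of z e] by (simp add: e)
    obtain v w :: "'b \<Rightarrow>\<^sub>C complex" where vw: "distr_laplacian \<Omega>2 v w"
      "\<And>y. y \<in> ball y0 r2 \<Longrightarrow> v y = h y * of_real ((\<tau> y - \<tau> y0) \<bullet> e)" "\<And>y. y \<in> ball y0 r2 \<Longrightarrow> w y = 0"
      using r2(3)[OF smooth_inner[of "\<tau> y0" e]] unfolding laplacian_inner by auto
    have v: "v y = v1 y * of_real ((y - y0) \<bullet> b)" if "y \<in> ball y0 r" for y
      using that vw(2) v1 aff by (simp add: r_def Ab)
    have v0: "v y0 = 0" using v r(1) by simp
    have "((\<lambda>s. LINT z|lborel. ((v1 (y0 + s *\<^sub>R z) - v1 y0) / of_real s * of_real (z \<bullet> b)) * of_real (kernel 2 z)) \<longlongrightarrow>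
      (LINT z|lborel. (D z * of_real (z \<bullet> b)) * of_real (kernel 2 z))) (at_right 0)"
    proof (rule tendsto_weighted_integral[OF _ _ _ _ R(1), where B="C * norm b"])
      show "continuous_on UNIV (\<lambda>z. (v1 (y0 + s *\<^sub>R z) - v1 y0) / of_real s * of_real (z \<bullet> b))" if "s \<in> {0<..<R}" for s
        using that by (intro continuous_intros continuous_on_bcontfun_compose) auto
      show "continuous_on UNIV (\<lambda>z. D z * of_real (z \<bullet> b))" by (intro continuous_intros cD)
    next
      fix s and z :: 'b assume s: "s \<in> {0<..<R}" and z: "z \<in> cball 0 1"
      have "norm (v1 (y0 + s *\<^sub>R z) - v1 y0) \<le> C * norm (s *\<^sub>R z)"
        using small[OF s z] R by (intro Cd(3)) simp
      also have "\<dots> \<le> C * s" using s z Cd(1) by (intro mult_left_mono) (auto simp: mult_left_le)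
      finally have "norm (v1 (y0 + s *\<^sub>R z) - v1 y0) / s \<le> C" using s by (simp add: field_simps)
      moreover have "\<bar>z \<bullet> b\<bar> \<le> norm b"
        using Cauchy_Schwarz_ineq2[of z b] z mult_right_mono[of "norm z" 1 "norm b"] by simp
      ultimately have "norm (v1 (y0 + s *\<^sub>R z) - v1 y0) / s * \<bar>z \<bullet> b\<bar> \<le> C * norm b"
        using Cd(1) by (intro mult_mono) auto
      then show "norm ((v1 (y0 + s *\<^sub>R z) - v1 y0) / of_real s * of_real (z \<bullet> b)) \<le> C * norm b"
        using s by (simp add: norm_mult norm_divide)
    next
      fix z :: 'b
      have "((\<lambda>s. y0 + s *\<^sub>R z) has_derivative (\<lambda>s. s *\<^sub>R z)) (at 0)"
        by (auto intro!: derivative_eq_intros)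
      moreover have "(apply_bcontfun v1 has_derivative D) (at (y0 + 0 *\<^sub>R z))" using D1 by simp
      ultimately have "((\<lambda>s. v1 (y0 + s *\<^sub>R z)) has_derivative (\<lambda>s. D (s *\<^sub>R z))) (at 0)"
        by (rule has_derivative_compose)
      then have "((\<lambda>s. norm (v1 (y0 + s *\<^sub>R z) - v1 y0 - s *\<^sub>R D z) / norm s) \<longlongrightarrow> 0) (at 0)"
        using linear_cmul[OF has_derivative_linear[OF D]] by (simp add: has_derivative_at)
      moreover have "\<forall>\<^sub>F s in at 0. norm (v1 (y0 + s *\<^sub>R z) - v1 y0 - s *\<^sub>R D z) / norm s
          = norm ((v1 (y0 + s *\<^sub>R z) - v1 y0) /\<^sub>R s - D z)"
        unfolding eventually_at
      proof (intro exI[of _ 1] conjI ballI impI)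
        fix s :: real assume "s \<noteq> 0 \<and> dist s 0 < 1"
        then have "(v1 (y0 + s *\<^sub>R z) - v1 y0) /\<^sub>R s - D z = (v1 (y0 + s *\<^sub>R z) - v1 y0 - s *\<^sub>R D z) /\<^sub>R s"
          by (simp add: scaleR_diff_right)
        then show "norm (v1 (y0 + s *\<^sub>R z) - v1 y0 - s *\<^sub>R D z) / norm s
          = norm ((v1 (y0 + s *\<^sub>R z) - v1 y0) /\<^sub>R s - D z)" by (simp add: divide_inverse mult.commute)
      qed simp
      ultimately have "((\<lambda>s. norm ((v1 (y0 + s *\<^sub>R z) - v1 y0) /\<^sub>R s - D z)) \<longlongrightarrow> 0) (at 0)"
        by (rule Lim_transform_eventually)
      then have "((\<lambda>s. (v1 (y0 + s *\<^sub>R z) - v1 y0) /\<^sub>R s) \<longlongrightarrow> D z) (at 0)"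
        by (rule Lim_null[THEN iffD2, OF tendsto_norm_zero_cancel])
      then have "((\<lambda>s. (v1 (y0 + s *\<^sub>R z) - v1 y0) /\<^sub>R s) \<longlongrightarrow> D z) (at_right 0)"
        by (rule tendsto_mono[OF at_le, rotated]) simp
      then have "((\<lambda>s. (v1 (y0 + s *\<^sub>R z) - v1 y0) /\<^sub>R s * of_real (z \<bullet> b)) \<longlongrightarrow> D z * of_real (z \<bullet> b)) (at_right 0)"
        by (intro tendsto_mult tendsto_const)
      moreover have "c /\<^sub>R s = c / of_real s" for c :: complex and s
        by (simp add: scaleR_conv_of_real divide_inverse mult.commute)
      ultimately show "((\<lambda>s. (v1 (y0 + s *\<^sub>R z) - v1 y0) / of_real s * of_real (z \<bullet> b)) \<longlongrightarrow> D z * of_real (z \<bullet> b)) (at_right 0)"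
        by (simp only:)
    qed
    moreover have "(LINT z|lborel. ((v1 (y0 + s *\<^sub>R z) - v1 y0) / of_real s * of_real (z \<bullet> b)) * of_real (kernel 2 z)) = 0"
      if s: "s \<in> {0<..<R}" for s
    proof -
      have "mean 2 v y0 s = v y0 * of_real (mass TYPE('b) 2)"
        by (rule mean_value_property[OF _ norm_bounded _ vw(1) r(2)])
           (use s R vw(3) in \<open>auto simp: r_def\<close>)
      then have m: "(LINT z|lborel. v (y0 + s *\<^sub>R z) * of_real (kernel 2 z)) = 0" by (simp add: v0 mean_def)
      \<comment> \<open>On the support of the kernel, \<open>v\<close> at y0 + s z is
        \<open>v1\<close> there times s (z . b), whence the factor 1/s^2. The subtracted constant
        \<open>v1 y0\<close> only contributes a first moment, which is zero.\<close>
      have "((v1 (y0 + s *\<^sub>R z) - v1 y0) / of_real s * of_real (z \<bullet> b)) * of_real (kernel 2 z) =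
          (1 / of_real (s\<^sup>2)) * (v (y0 + s *\<^sub>R z) * of_real (kernel 2 z)) - (v1 y0 / of_real s) * of_real ((z \<bullet> b) * kernel 2 z)" for z
      proof (cases "z \<in> cball 0 1")
        case True
        then have "y0 + s *\<^sub>R z \<in> ball y0 r" using small[OF s True] R by (simp add: dist_norm)
        then show ?thesis using v s by (simp add: power2_eq_square field_simps)
      qed (simp add: kernel_zero)
      then have "(LINT z|lborel. ((v1 (y0 + s *\<^sub>R z) - v1 y0) / of_real s * of_real (z \<bullet> b)) * of_real (kernel 2 z)) =
        (LINT z|lborel. (1 / of_real (s\<^sup>2)) * (v (y0 + s *\<^sub>R z) * of_real (kernel 2 z)) - (v1 y0 / of_real s) * of_real ((z \<bullet> b) * kernel 2 z))"
        by (simp only:)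
      also have "\<dots> = (LINT z|lborel. (1 / of_real (s\<^sup>2)) * (v (y0 + s *\<^sub>R z) * of_real (kernel 2 z)))
          - (LINT z|lborel. (v1 y0 / of_real s) * of_real ((z \<bullet> b) * kernel 2 z))"
        by (rule Bochner_Integration.integral_diff; rule integrable_compact_support'[OF _ bounded_cball[of 0 1]])
           (use s in \<open>auto intro!: continuous_intros continuous_on_bcontfun_compose simp: kernel_zero\<close>)
      also have "\<dots> = 0"
        by (simp only: integral_mult_right_zero m integral_complex_of_real first_moment) simp
      finally show ?thesis .
    qed
    then have "\<forall>\<^sub>F s in at_right 0. (LINT z|lborel. ((v1 (y0 + s *\<^sub>R z) - v1 y0) / of_real s * of_real (z \<bullet> b)) * of_real (kernel 2 z)) = 0"
      unfolding eventually_at_right_field using R(1) by (intro exI[of _ R]) auto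
    ultimately show ?thesis
      by (intro tendsto_unique[OF trivial_limit_at_right_real _ tendsto_eventually])
  qed
  \<comment> \<open>Here \<open>f\<close> is the real or imaginary part. The functional z \<mapsto>
    f (D z) is the inner product with a vector \<open>a\<close>; choosing b = a in
    \<open>key\<close> makes the second moment |a|^2 / 2 times a positive mass equal to
    zero.\<close>
  have zero: "f (D z) = 0" if f: "bounded_linear f" and ff: "\<And>c t. f (c * complex_of_real t) = f c * t" for f :: "complex \<Rightarrow> real" and z
  proof -
    define a where "a = adjoint (\<lambda>z. f (D z)) 1"
    have "bounded_linear (\<lambda>z. f (D z))"
      using bounded_linear_compose[OF f has_derivative_bounded_linear[OF D]] .
    then have fa: "f (D z) = z \<bullet> a" for z
      using adjoint_works[of "\<lambda>z. f (D z)" z 1] by (simp add: a_def bounded_linear.linear)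
    have "integrable lborel (\<lambda>z. D z * of_real (z \<bullet> a) * of_real (kernel 2 z))"
      by (rule integrable_compact_support'[OF _ bounded_cball[of 0 1]])
         (auto intro!: continuous_intros cD simp: kernel_zero)
    from integral_bounded_linear[OF f this] key[of a]
    have "(LINT z|lborel. f (D z * of_real (z \<bullet> a) * of_real (kernel 2 z))) = 0"
      using linear_0[OF bounded_linear.linear[OF f]] by simp
    then have "(LINT z|lborel. (z \<bullet> a) * (z \<bullet> a) * kernel 2 z) = 0" by (simp add: ff fa)
    then have "a \<bullet> a = 0" using mass_pos[where 'a='b, of 0] by (simp add: second_moment)
    then show ?thesis by (simp add: fa)
  qed
  have "D z = 0" for z
    using zero[OF bounded_linear_Re] zero[OF bounded_linear_Im] by (simp add: complex_eq_iff)
  then have "D = (\<lambda>z. 0)" by auto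
  with D show ?thesis by simp
qed

section \<open>From local to global rigidity\<close>

lemma rigid_on_component:
  assumes y0: "y0 \<in> \<Omega>2" and C: "C = connected_component_set \<Omega>2 y0"
    and A: "(\<tau> has_derivative A) (at y0)"
  shows "\<And>y. y \<in> C \<Longrightarrow> \<tau> y = \<tau> y0 + A (y - y0)" "\<And>y. y \<in> C \<Longrightarrow> h y = h y0"
proof -
  have C': "C \<subseteq> \<Omega>2" "open C" "connected C" "y0 \<in> C"
    using y0 open2 by (auto simp: C connected_component_subset open_connected_component)
  have "h constant_on C"
  proof (rule has_derivative_zero_connected_constant_on[OF C'(3,2), of "{}"])
    show "continuous_on C h"
      using derivative_h_zero C'(1) by (meson continuous_at_imp_continuous_on has_derivative_continuous subsetD)
    show "\<forall>x\<in>C - {}. (h has_derivative (\<lambda>h. 0)) (at x within C)"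
      using derivative_h_zero C'(1) by (blast intro: has_derivative_at_withinI)
  qed simp
  then show "h y = h y0" if "y \<in> C" for y using that C'(4) unfolding constant_on_def by metis
  define F where "F y = frechet_derivative \<tau> (at y)" for y
  have F: "(\<tau> has_derivative F y) (at y)" if "y \<in> \<Omega>2" for y
    using differentiable_tau[OF that] by (simp add: F_def frechet_derivative_works)
  \<comment> \<open>The first-order Taylor map at \<open>y\<close>, regarded as a function of
    \<open>z\<close>, is the same for all nearby \<open>y\<close> because \<open>\<tau>\<close> is
    affine there. Treating it as one function-valued quantity handles derivative and offset
    together.\<close>
  have "(\<lambda>y z. \<tau> y + F y (z - y)) constant_on C"
  proof (rule locally_constant_imp_constant[OF C'(3)])
    fix a assume a: "a \<in> C"
    then have a2: "a \<in> \<Omega>2" using C' by blast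
    obtain r B where r: "0 < r" "ball a r \<subseteq> \<Omega>2" "(\<tau> has_derivative B) (at a)"
      "\<And>y. y \<in> ball a r \<Longrightarrow> \<tau> y = \<tau> a + B (y - a)"
      using tau_locally_affine[OF a2] by blast
    have B: "bounded_linear B" by (rule has_derivative_bounded_linear[OF r(3)])
    have FB: "F y = B" if "y \<in> ball a r" for y
    proof -
      have "((\<lambda>y. \<tau> a + B (y - a)) has_derivative B) (at y)"
        by (auto intro!: derivative_eq_intros bounded_linear.has_derivative[OF B])
      then have "(\<tau> has_derivative B) (at y)"
        by (rule has_derivative_transform_within_open[OF _ open_ball that]) (simp add: r(4))
      then show ?thesis using F[of y] r(2) that has_derivative_unique by blast
    qed
    have "(\<lambda>z. \<tau> y + F y (z - y)) = (\<lambda>z. \<tau> a + F a (z - a))" if "y \<in> ball a r" for y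
    proof
      fix z
      have "B (z - y) = B (z - a) - B (y - a)"
        using bounded_linear.linear[OF B] by (simp flip: linear_diff)
      then show "\<tau> y + F y (z - y) = \<tau> a + F a (z - a)"
        using r(1) FB[OF that] FB[of a] r(4)[OF that] by simp
    qed
    moreover have "openin (top_of_set C) (C \<inter> ball a r)" by (simp add: openin_open_Int)
    ultimately show "\<exists>T. openin (top_of_set C) T \<and> a \<in> T \<and> (\<forall>y\<in>T. (\<lambda>z. \<tau> y + F y (z - y)) = (\<lambda>z. \<tau> a + F a (z - a)))"
      using a r(1) by (metis IntD2 IntI centre_in_ball)
  qed
  then obtain f where f: "\<And>y. y \<in> C \<Longrightarrow> (\<lambda>z. \<tau> y + F y (z - y)) = f"
    unfolding constant_on_def by blast
  have "F y0 = A" using has_derivative_unique[OF F[OF y0] A] .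
  then show "\<tau> y = \<tau> y0 + A (y - y0)" if "y \<in> C" for y
  proof -
    have "\<tau> y = f y" 
      using fun_cong[OF f[OF that], of y] linear_0[OF has_derivative_linear[OF F[of y]]] that C' by auto
    also have "f y = \<tau> y0 + F y0 (y - y0)" using fun_cong[OF f[OF C'(4)], of y] by simp
    finally show ?thesis using \<open>F y0 = A\<close> by simp
  qed
qed

lemma rigid:
  assumes conn: "connected \<Omega>1" and bdd: "bounded \<Omega>2" and ne: "\<Omega>2 \<noteq> {}"
  shows "\<exists>(T :: 'b \<Rightarrow> 'a) c. (\<forall>x y. dist (T x) (T y) = dist x y) \<and> T ` \<Omega>2 = \<Omega>1 \<and> c \<noteq> 0 \<and>
    (\<forall>y\<in>\<Omega>2. \<tau> y = T y \<and> h y = c)"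
proof -
  obtain y0 where y0: "y0 \<in> \<Omega>2" using ne by blast
  obtain A where A: "(\<tau> has_derivative A) (at y0)" using differentiable_tau[OF y0] by (auto simp: differentiable_def)
  define C where "C = connected_component_set \<Omega>2 y0"
  have C': "C \<subseteq> \<Omega>2" "open C" "y0 \<in> C"
    using y0 open2 by (auto simp: C_def connected_component_subset open_connected_component)
  \<comment> \<open>This affine isometry extends \<open>\<tau>\<close> from \<open>C\<close> to the
    whole space, so limits can be taken at boundary points of \<open>C\<close>, where
    \<open>\<tau>\<close> carries no information.\<close>
  define T where "T y = \<tau> y0 + A (y - y0)" for y
  note rig = rigid_on_component[OF y0 C_def A, folded T_def]
  have lA: "linear A" by (rule has_derivative_linear[OF A])
  have iso: "dist (T x) (T y) = dist x y" for x y
    using derivative_orthogonal(3)[OF y0 A, of "x - y"] linear_diff[OF lA, of "x - y0" "y - y0"]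
    by (simp add: T_def dist_norm)
  have cT: "continuous_on S T" for S
    unfolding continuous_on_iff iso by blast
  have TC: "T ` C = \<tau> ` C" using rig(1) by auto
  have "open (\<tau> ` C)"
    using C' dim_eq[OF y0] 
    by (intro invariance_of_domain_gen continuous_on_subset[OF continuous_tau] inj_on_subset[OF inj_tau]) auto
  moreover have sub: "\<tau> ` C \<subseteq> \<Omega>1" using C' tau_in by blast
  ultimately have "openin (top_of_set \<Omega>1) (\<tau> ` C)" by (auto simp: openin_open)
  moreover have "closedin (top_of_set \<Omega>1) (\<tau> ` C)"
    unfolding closedin_limpt
  proof (intro conjI allI impI sub)
    fix p assume p: "p islimpt \<tau> ` C \<and> p \<in> \<Omega>1"
    then obtain q where q: "\<And>n. q n \<in> \<tau> ` C - {p}" "q \<longlonglongrightarrow> p"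
      using islimpt_sequential by blast
    then have "\<exists>y. y \<in> C \<and> q n = \<tau> y" for n by blast
    then obtain y where y: "\<And>n. y n \<in> C" "\<And>n. q n = \<tau> (y n)" by metis
    have "bounded C" using bdd C'(1) bounded_subset by blast
    then have "bounded (range y)" using y(1) by (meson bounded_subset image_subsetI)
    then obtain x k where x: "strict_mono (k :: nat \<Rightarrow> nat)" "(y \<circ> k) \<longlonglongrightarrow> x"
      using bounded_imp_convergent_subsequence by blast
    have "isCont T x" using cT[of UNIV] by (simp add: continuous_on_eq_continuous_at)
    then have "(\<lambda>n. T ((y \<circ> k) n)) \<longlonglongrightarrow> T x" using x(2) isCont_tendsto_compose by blast
    moreover have "(\<lambda>n. T ((y \<circ> k) n)) = q \<circ> k" using y rig(1) by auto
    moreover have "(q \<circ> k) \<longlonglongrightarrow> p" by (rule LIMSEQ_subseq_LIMSEQ[OF q(2) x(1)])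
    ultimately have Tx: "T x = p" using LIMSEQ_unique by metis
    have xcl: "x \<in> closure C" unfolding closure_sequential using x(2) y(1) by (intro exI[of _ "y \<circ> k"]) simp
    have "x \<in> \<Omega>2"
    proof (rule ccontr)
      assume nx: "x \<notin> \<Omega>2"
      obtain u r where u: "0 < (r::real)" "u \<in> test_functions \<Omega>1" "\<And>z. z \<in> cball p r \<Longrightarrow> u z = 1"
        using cutoff_test[OF open1] p by metis
      have "U (Bcontfun u) \<in> C0 \<Omega>2" using test_C0[OF u(2)] image_U by blast
      then have "U (Bcontfun u) x = 0" using nx by (rule C0_zero)
      \<comment> \<open>The identity holds on \<open>C\<close>, and both sides are continuous on the
        whole space since \<open>T\<close> replaces \<open>\<tau>\<close>; it therefore passes to
        the closure.\<close>
      moreover have "U (Bcontfun u) x = h y0 * u (T x)"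
      proof -
        have "closed {z. U (Bcontfun u) z = h y0 * u (T z)}"
          using continuous_on_compose2[OF smooth_continuous[OF test_smooth[OF u(2)], of UNIV] cT[of UNIV] subset_UNIV]
          by (intro closed_Collect_eq continuous_intros) auto
        moreover have "C \<subseteq> {z. U (Bcontfun u) z = h y0 * u (T z)}"
          using rep_test[OF u(2)] C'(1) rig by auto
        ultimately show ?thesis using xcl closure_minimal by blast
      qed
      moreover have "u p = 1" using u by simp
      ultimately show False using Tx h_nonzero[OF y0] by simp
    qed
    then have "x \<in> C"
    proof -
      have "closedin (top_of_set \<Omega>2) C" unfolding C_def by (rule closedin_connected_component)
      then obtain D where D: "closed D" "C = \<Omega>2 \<inter> D" by (auto simp: closedin_closed)
      then show ?thesis using \<open>x \<in> \<Omega>2\<close> xcl closure_minimal[of C D] by blast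
    qed
    then show "p \<in> \<tau> ` C" using Tx TC by blast
  qed
  ultimately have im: "\<tau> ` C = \<Omega>1" using conn C'(3) unfolding connected_clopen by blast
  \<comment> \<open>Since \<open>C\<close> already covers \<open>\<Omega>1\<close> under
    \<open>\<tau>\<close>, a point outside \<open>C\<close> would share its image with a point of
    \<open>C\<close>, against injectivity.\<close>
  have "\<Omega>2 \<subseteq> C"
  proof
    fix y assume y: "y \<in> \<Omega>2"
    then obtain z where z: "z \<in> C" "\<tau> y = \<tau> z" using tau_in[OF y] im by blast
    then show "y \<in> C" using inj_onD[OF inj_tau z(2) y] C'(1) by blast
  qed
  then have "C = \<Omega>2" using C' by blast
  then show ?thesis
    using iso im TC h_nonzero[OF y0] rig by (intro exI[of _ T] exI[of _ "h y0"]) auto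
qed

end

section \<open>Reduction of the operator to a weighted composition\<close>

theorem corollary4p7:
  fixes \<Omega>1 :: "'a::euclidean_space set" and \<Omega>2 :: "'b::euclidean_space set"
    and U :: "('a \<Rightarrow>\<^sub>C complex) \<Rightarrow> ('b \<Rightarrow>\<^sub>C complex)"
  assumes "open \<Omega>1" "bounded \<Omega>1" "\<Omega>1 \<noteq> {}" "dirichlet_regular \<Omega>1"
    and "open \<Omega>2" "bounded \<Omega>2" "\<Omega>2 \<noteq> {}" "dirichlet_regular \<Omega>2"
    and "connected \<Omega>1"
    and "bounded_operator \<Omega>1 \<Omega>2 U"
    and "bij_betw U (C0 \<Omega>1) (C0 \<Omega>2)"
    and "disjointness_preserving \<Omega>1 \<Omega>2 U"
    and "intertwines U (dom_dirichlet_laplacian \<Omega>1) (dirichlet_laplacian \<Omega>1)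
                       (dom_dirichlet_laplacian \<Omega>2) (dirichlet_laplacian \<Omega>2)"
  shows "DIM('a) = DIM('b) \<and>
    (\<exists>(\<tau> :: 'b \<Rightarrow> 'a) (c :: complex).
       (\<forall>x y. dist (\<tau> x) (\<tau> y) = dist x y) \<and> \<tau> ` \<Omega>2 = \<Omega>1 \<and> c \<noteq> 0 \<and>
       (\<forall>f\<in>C0 \<Omega>1. \<forall>x\<in>\<Omega>2. apply_bcontfun (U f) x = c * apply_bcontfun f (\<tau> x)))"
proof -
  have im: "U ` C0 \<Omega>1 = C0 \<Omega>2" using \<open>bij_betw U _ _\<close> by (simp add: bij_betw_def)
  obtain K where U: "\<And>f. f \<in> C0 \<Omega>1 \<Longrightarrow> U f \<in> C0 \<Omega>2"
    "\<And>f g. f \<in> C0 \<Omega>1 \<Longrightarrow> g \<in> C0 \<Omega>1 \<Longrightarrow> U (f + g) = U f + U g"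
    "\<And>a f. f \<in> C0 \<Omega>1 \<Longrightarrow> U (cscale a f) = cscale a (U f)"
    "\<And>f. f \<in> C0 \<Omega>1 \<Longrightarrow> norm (U f) \<le> K * norm f"
    using \<open>bounded_operator \<Omega>1 \<Omega>2 U\<close> unfolding bounded_operator_def by metis
  have "\<exists>p c. p \<in> \<Omega>1 \<and> c \<noteq> 0 \<and> (\<forall>f\<in>C0 \<Omega>1. U f y = c * f p)" if y: "y \<in> \<Omega>2" for y
  proof -
    interpret disjointness_preserving_functional \<Omega>1 "\<lambda>f. U f y" K
    proof
      show "norm (U f y) \<le> K * norm f" if "f \<in> C0 \<Omega>1" for f
        using order_trans[OF norm_bounded U(4)[OF that]] .
      show "U f y * U g y = 0" if "f \<in> C0 \<Omega>1" "g \<in> C0 \<Omega>1" "\<And>x. f x * g x = 0" for f g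
        using \<open>disjointness_preserving \<Omega>1 \<Omega>2 U\<close> that y unfolding disjointness_preserving_def by blast
      \<comment> \<open>Surjectivity of \<open>U\<close> makes the functional nonzero: a cutoff
        equal to 1 at \<open>y\<close> is in the range.\<close>
      obtain u r where u: "0 < (r::real)" "u \<in> test_functions \<Omega>2" "\<And>z. z \<in> cball y r \<Longrightarrow> u z = 1"
        using cutoff_test[OF \<open>open \<Omega>2\<close> y] by metis
      obtain f where "f \<in> C0 \<Omega>1" "U f = Bcontfun u" using im test_C0[OF u(2)] by (metis imageE)
      then show "\<exists>f\<in>C0 \<Omega>1. U f y \<noteq> 0" using u by (intro bexI[of _ f]) (simp_all add: test_bcontfun[OF u(2)])
    qed (use U \<open>open \<Omega>1\<close> in auto)
    show ?thesis using point_evaluation by blast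
  qed
  then obtain \<tau> h where th: "\<And>y. y \<in> \<Omega>2 \<Longrightarrow> \<tau> y \<in> \<Omega>1" "\<And>y. y \<in> \<Omega>2 \<Longrightarrow> h y \<noteq> 0"
    "\<And>f y. f \<in> C0 \<Omega>1 \<Longrightarrow> y \<in> \<Omega>2 \<Longrightarrow> U f y = h y * f (\<tau> y)"
    by metis
  interpret weighted_composition \<Omega>1 \<Omega>2 U h \<tau>
  proof
    fix \<phi> assume \<phi>: "\<phi> \<in> test_functions \<Omega>1"
    let ?u = "Bcontfun \<phi>" and ?w = "Bcontfun (laplacian \<phi>)"
    \<comment> \<open>The Laplacian of a test function is again a test function, so
      \<open>\<phi>\<close> lies in the domain of the Dirichlet Laplacian.\<close>
    have w: "?w \<in> C0 \<Omega>1" "distr_laplacian \<Omega>1 ?u ?w"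
      using test_C0[OF test_laplacian[OF \<phi>]] distr_laplacian_test[OF \<phi>]
      by (simp_all add: test_bcontfun[OF \<phi>] test_bcontfun[OF test_laplacian[OF \<phi>]])
    then have "?u \<in> dom_dirichlet_laplacian \<Omega>1"
      unfolding dom_dirichlet_laplacian_def using test_C0[OF \<phi>] by blast
    moreover have "dirichlet_laplacian \<Omega>1 ?u = ?w"
      by (rule dirichlet_laplacian_eqI[OF \<open>open \<Omega>1\<close> \<open>bounded \<Omega>1\<close> w])
    ultimately have *: "U ?u \<in> dom_dirichlet_laplacian \<Omega>2" "dirichlet_laplacian \<Omega>2 (U ?u) = U ?w"
      using \<open>intertwines U _ _ _ _\<close> unfolding intertwines_def by auto
    \<comment> \<open>Membership in the domain yields only some distributional Laplacian
      \<open>z\<close>; uniqueness identifies it with \<open>U ?w\<close>.\<close>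
    then obtain z where z: "z \<in> C0 \<Omega>2" "distr_laplacian \<Omega>2 (U ?u) z"
      unfolding dom_dirichlet_laplacian_def by blast
    then show "distr_laplacian \<Omega>2 (U ?u) (U ?w)"
      using dirichlet_laplacian_eqI[OF \<open>open \<Omega>2\<close> \<open>bounded \<Omega>2\<close> z] *(2) by simp
  qed (use th im \<open>open \<Omega>1\<close> \<open>open \<Omega>2\<close> in auto)
  obtain T :: "'b \<Rightarrow> 'a" and c where T: "\<forall>x y. dist (T x) (T y) = dist x y" "T ` \<Omega>2 = \<Omega>1" "c \<noteq> 0"
    "\<forall>y\<in>\<Omega>2. \<tau> y = T y \<and> h y = c"
    using rigid[OF \<open>connected \<Omega>1\<close> \<open>bounded \<Omega>2\<close> \<open>\<Omega>2 \<noteq> {}\<close>] by blast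
  have "DIM('a) = DIM('b)" using dim_eq \<open>\<Omega>2 \<noteq> {}\<close> by blast
  moreover have "U f x = c * f (T x)" if "f \<in> C0 \<Omega>1" "x \<in> \<Omega>2" for f x
    using th(3)[OF that] T(4) that(2) by simp
  ultimately show ?thesis using T(1,2,3) by blast
qed

end
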